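(* For each $n\ge2$ let $d=d_n\ge2$, $\mathbf{y}\in\{\pm1\}^n$, $\boldsymbol\mu\in\mathbb{R}^d$ be deterministic, and let $\mathbf{x}_i=y_i\boldsymbol\mu+\mathbf{z}_i$, $i\in[n]$, with $\mathbf{z}_1,\dots,\mathbf{z}_n$ i.i.d. $N(\mathbf{0},\mathbf{I}_d)$. Let $\mathbf{u}_1$ be a leading (unit) eigenvector of $\mathbf{G}=\mathcal{H}(\mathbf{X}\mathbf{X}^\top)$ and $\hat{\mathbf{y}}=\mathrm{sgn}(\mathbf{u}_1)$ (entrywise). Let $\mathrm{SNR}=\|\boldsymbol\mu\|_2^4/(\|\boldsymbol\mu\|_2^2+d/n)$ and $n\to\infty$. 1. If $\mathrm{SNR}>(2+\varepsilon)\log n$ for some constant $\varepsilon>0$, then $\lim_{n\to\infty}\mathbb{P}[\mathcal{M}(\hat{\mathbf{y}},\mathbf{y})=0]=1$. 2. If $\mathrm{SNR}\to\infty$ and $\mathrm{SNR}\le2\log n$, then $\limsup_{n\to\infty}\mathrm{SNR}^{-1}\log\mathbb{E}\mathcal{M}(\hat{\mathbf{y}},\mathbf{y})\le-1/2$.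
   Context: $\mathbf{X}=(\mathbf{x}_1,\dots,\mathbf{x}_n)^\top$; $\mathcal{H}$ sets the diagonal of a square matrix to zero. $\mathcal{M}(\hat{\mathbf{y}},\mathbf{y})=\frac1n\min_{s=\pm1}|\{i\in[n]:\hat y_i\ne sy_i\}|$. *)

theory Defs
  imports "HOL-Probability.Probability" "Jordan_Normal_Form.Char_Poly"
begin

definition std_normal :: "real measure" where
  "std_normal = density lborel std_normal_density"

text \<open>Sample space of the noise: z_{i,k}, i < n, k < d, i.i.d. N(0,1),
  i.e. z_1,...,z_n i.i.d. N(0, I_d).\<close>
definition noise_space :: "nat \<Rightarrow> nat \<Rightarrow> ((nat \<times> nat) \<Rightarrow> real) measure" where
  "noise_space n d = PiM ({..<n} \<times> {..<d}) (\<lambda>_. std_normal)"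

definition data_x :: "(nat \<Rightarrow> real) \<Rightarrow> (nat \<Rightarrow> real) \<Rightarrow> ((nat \<times> nat) \<Rightarrow> real) \<Rightarrow> nat \<Rightarrow> nat \<Rightarrow> real" where
  "data_x y mu z i k = y i * mu k + z (i, k)"

definition hollow_gram :: "nat \<Rightarrow> nat \<Rightarrow> (nat \<Rightarrow> real) \<Rightarrow> (nat \<Rightarrow> real) \<Rightarrow> ((nat \<times> nat) \<Rightarrow> real) \<Rightarrow> real mat" where
  "hollow_gram n d y mu z = mat n n (\<lambda>(i, j). if i = j then 0
      else (\<Sum>k<d. data_x y mu z i k * data_x y mu z j k))"

definition leading_unit_eigvec :: "real mat \<Rightarrow> real vec \<Rightarrow> bool" where
  "leading_unit_eigvec G u \<longleftrightarrow>
     (\<exists>lam. eigenvector G u lam \<and> (\<forall>m. eigenvalue G m \<longrightarrow> m \<le> lam)) \<and> u \<bullet> u = 1"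

definition misclass :: "nat \<Rightarrow> (nat \<Rightarrow> real) \<Rightarrow> (nat \<Rightarrow> real) \<Rightarrow> real" where
  "misclass n yhat y = (1 / real n) *
     real (min (card {i\<in>{..<n}. yhat i \<noteq> y i}) (card {i\<in>{..<n}. yhat i \<noteq> - y i}))"

definition SNR :: "nat \<Rightarrow> nat \<Rightarrow> (nat \<Rightarrow> real) \<Rightarrow> real" where
  "SNR n d mu = (\<Sum>k<d. (mu k)\<^sup>2)\<^sup>2 / ((\<Sum>k<d. (mu k)\<^sup>2) + real d / real n)"

definition ln_ext :: "real \<Rightarrow> ereal" where
  "ln_ext x = (if x \<le> 0 then -\<infinity> else ereal (ln x))"

end

theory Submission
  imports Defs "HOL-Real_Asymp.Real_Asymp"
begin

text \<open>
  Leave-one-out argument. Let \<open>u'\<close> be the leading eigenvector after the \<open>i\<close>-th data point has been replaced by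
  \<open>0\<close>; it does not depend on \<open>z\<^sub>i\<close>, and \<open>u'\<^sub>i = 0\<close>. With \<open>q = (\<Sum>j. u'\<^sub>j x\<^sub>j)\<close>, pairing the two eigenvector
  equations gives \<open>u\<^sub>i \<langle>x\<^sub>i, q\<rangle> = (\<lambda> - \<lambda>') \<langle>u, u'\<rangle>\<close> with \<open>\<lambda> > \<lambda>'\<close> unless \<open>\<langle>x\<^sub>i, q\<rangle> = 0\<close>. Both eigenvectors are nearly
  parallel to \<open>y\<close> as soon as the hollow Gram form of the noise is uniformly \<open>O(sqrt (n d) + n)\<close>, which fails
  only with probability \<open>O(exp (- n))\<close>. Then the sign of \<open>u\<^sub>i\<close> is wrong only if \<open>\<bar>\<langle>z\<^sub>i, q\<rangle>\<bar> \<ge> \<bar>\<langle>\<mu>, q\<rangle>\<bar>\<close>, where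
  \<open>\<langle>\<mu>, q\<rangle>\<^sup>2 \<ge> (1 - o(1)) SNR \<bar>q\<bar>\<^sup>2\<close>; since \<open>z\<^sub>i\<close> is independent of \<open>q\<close>, this has probability at most
  \<open>2 exp (- (1 - o(1)) SNR / 2)\<close>.
\<close>

section \<open>Gaussian moment bounds\<close>

text \<open>The obstacle is that \<open>u\<close> itself depends on the noise row whose effect on
  the \<open>i\<close>-th entry is to be measured. The loss sees only signs, and the pairing
  identity yields the sign of that entry from two signs: that of an inner product of data with
  \<open>q\<close>, and that of the inner product of \<open>u\<close> and \<open>u'\<close>. Rough
  spectral bounds are enough for both: relative to the signal \<open>n * m\<^sup>2\<close> all
  errors have order \<open>1 / n + 1 / sqrt SNR\<close>, so generous constants do no harm. Only the
  variance of the one Gaussian form in row \<open>i\<close> must be sharp, since it produces the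
  exponent 1/2.

  The vector \<open>u'\<close> is the same selection \<open>u\<close>, evaluated at a noise array
  whose row \<open>i\<close> is overwritten by \<open>- (y i * mu l)\<close>. It thus inherits
  measurability and the leading property, and takes equal values on arrays differing only in row
  \<open>i\<close>. Regularity is required at the original array alone, because \<open>u'\<close>
  vanishes at \<open>i\<close>.

  A unit eigenvector is fixed at best up to sign. Errors are counted against \<open>y\<close> times
  the sign of the inner product of \<open>y\<close> and \<open>u\<close>; the minimum in the loss
  absorbs this choice.\<close>

lemma space_std_normal [simp]: "space std_normal = UNIV"
  by (simp add: std_normal_def)

lemma sets_std_normal [simp, measurable_cong]: "sets std_normal = sets borel"
  by (simp add: std_normal_def)

interpretation std_normal: prob_space std_normal
  unfolding std_normal_def by (rule prob_space_normal_density) simp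

lemma prob_space_PiM_std_normal: "prob_space (PiM I (\<lambda>_. std_normal))"
  by (intro prob_space_PiM std_normal.prob_space_axioms)

lemma product_sigma_finite_std_normal: "product_sigma_finite (\<lambda>_. std_normal)"
  by (simp add: product_sigma_finite_def std_normal.sigma_finite_measure_axioms)

lemma borel_measurable_PiM_std_normal_component [measurable (raw)]:
  "i \<in> I \<Longrightarrow> (\<lambda>z. z i) \<in> borel_measurable (PiM I (\<lambda>_. std_normal))"
  using measurable_component_singleton[of i I "\<lambda>_. std_normal"]
  by (simp cong: measurable_cong_sets)

lemma distr_PiM_std_normal_component:
  assumes "finite I" "i \<in> I"
  shows "distr (PiM I (\<lambda>_. std_normal)) borel (\<lambda>z. z i) = std_normal"
proof -
  have "distr (PiM I (\<lambda>_. std_normal)) std_normal (\<lambda>z. z i) = std_normal"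
    using assms by (intro distr_PiM_component std_normal.prob_space_axioms)
  then show ?thesis by (simp cong: distr_cong)
qed

lemma nn_integral_normal_density:
  "0 < \<sigma> \<Longrightarrow> (\<integral>\<^sup>+ x. ennreal (normal_density \<mu> \<sigma> x) \<partial>lborel) = 1"
  using prob_space.emeasure_space_1[OF prob_space_normal_density, of \<sigma> \<mu>]
  by (simp add: emeasure_density)

lemma nn_integral_std_normal_exp_linear:
  "(\<integral>\<^sup>+ x. ennreal (exp (t * x)) \<partial>std_normal) = ennreal (exp (t\<^sup>2 / 2))"
proof -
  have *: "std_normal_density x * exp (t * x) = exp (t\<^sup>2 / 2) * normal_density t 1 x" for x
  proof -
    have "-(x\<^sup>2 / 2) + t * x = t\<^sup>2 / 2 + -((x - t)\<^sup>2 / 2)"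
      by (simp add: power2_eq_square field_simps)
    then have "exp (-(x\<^sup>2 / 2)) * exp (t * x) = exp (t\<^sup>2 / 2) * exp (-((x - t)\<^sup>2 / 2))"
      by (simp only: exp_add[symmetric])
    then show ?thesis by (simp add: normal_density_def)
  qed
  have "(\<integral>\<^sup>+ x. ennreal (exp (t * x)) \<partial>std_normal)
      = (\<integral>\<^sup>+ x. ennreal (std_normal_density x * exp (t * x)) \<partial>lborel)"
    unfolding std_normal_def by (subst nn_integral_density) (auto simp: ennreal_mult)
  also have "\<dots> = (\<integral>\<^sup>+ x. ennreal (exp (t\<^sup>2 / 2)) * ennreal (normal_density t 1 x) \<partial>lborel)"
    by (simp add: * ennreal_mult)
  also have "\<dots> = ennreal (exp (t\<^sup>2 / 2))"
    by (subst nn_integral_cmult) (auto simp: nn_integral_normal_density)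
  finally show ?thesis .
qed

lemma nn_integral_std_normal_exp_square:
  assumes "s < 1 / 2"
  shows "(\<integral>\<^sup>+ x. ennreal (exp (s * x\<^sup>2)) \<partial>std_normal) = ennreal (1 / sqrt (1 - 2 * s))"
proof -
  define \<sigma> where "\<sigma> = 1 / sqrt (1 - 2 * s)"
  have pos: "0 < \<sigma>" and sq: "\<sigma>\<^sup>2 = 1 / (1 - 2 * s)"
    using assms by (auto simp: \<sigma>_def power_divide)
  have *: "std_normal_density x * exp (s * x\<^sup>2) = \<sigma> * normal_density 0 \<sigma> x" for x
  proof -
    have "-(x\<^sup>2 / 2) + s * x\<^sup>2 = -(x\<^sup>2 / (2 * \<sigma>\<^sup>2))"
      using assms by (simp add: sq field_simps)
    then have "exp (-(x\<^sup>2 / 2)) * exp (s * x\<^sup>2) = exp (-(x\<^sup>2 / (2 * \<sigma>\<^sup>2)))"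
      by (simp only: exp_add[symmetric])
    then show ?thesis using pos by (simp add: normal_density_def real_sqrt_mult)
  qed
  have "(\<integral>\<^sup>+ x. ennreal (exp (s * x\<^sup>2)) \<partial>std_normal)
      = (\<integral>\<^sup>+ x. ennreal (std_normal_density x * exp (s * x\<^sup>2)) \<partial>lborel)"
    unfolding std_normal_def by (subst nn_integral_density) (auto simp: ennreal_mult)
  also have "\<dots> = (\<integral>\<^sup>+ x. ennreal \<sigma> * ennreal (normal_density 0 \<sigma> x) \<partial>lborel)"
    using pos by (simp add: * ennreal_mult)
  also have "\<dots> = ennreal \<sigma>"
    using pos by (subst nn_integral_cmult) (auto simp: nn_integral_normal_density)
  finally show ?thesis by (simp add: \<sigma>_def)
qed

text \<open>The logarithm of the integral is \<open>- s - ln (1 - 2 * s) / 2\<close>. The linear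
  terms cancel, and the second-order bound on \<open>ln (1 + x)\<close> at
  \<open>x = - 2 * s\<close> leaves \<open>4 * s\<^sup>2\<close>; its range, |x| at most 1/2, is the
  hypothesis on \<open>s\<close>.\<close>

lemma nn_integral_std_normal_exp_centered_square_le:
  assumes "\<bar>s\<bar> \<le> 1 / 4"
  shows "(\<integral>\<^sup>+ x. ennreal (exp (s * (x\<^sup>2 - 1))) \<partial>std_normal) \<le> ennreal (exp (4 * s\<^sup>2))"
proof -
  have "\<bar>ln (1 + (- 2 * s)) - (- 2 * s)\<bar> \<le> 2 * (- 2 * s)\<^sup>2"
    using assms by (intro abs_ln_one_plus_x_minus_x_bound) auto
  then have "- (ln (1 - 2 * s) / 2) \<le> s + 4 * s\<^sup>2"
    by (auto simp: power2_eq_square abs_if split: if_splits)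
  moreover have "1 / sqrt (1 - 2 * s) = exp (- (ln (1 - 2 * s) / 2))"
    using assms by (simp add: exp_minus inverse_eq_divide ln_sqrt[symmetric] field_simps)
  ultimately have le: "exp (- s) * (1 / sqrt (1 - 2 * s)) \<le> exp (4 * s\<^sup>2)"
    by (simp add: exp_add[symmetric])
  have "(\<integral>\<^sup>+ x. ennreal (exp (s * (x\<^sup>2 - 1))) \<partial>std_normal)
      = (\<integral>\<^sup>+ x. ennreal (exp (- s)) * ennreal (exp (s * x\<^sup>2)) \<partial>std_normal)"
    by (simp add: ennreal_mult[symmetric] exp_add[symmetric] algebra_simps)
  also have "\<dots> = ennreal (exp (- s)) * ennreal (1 / sqrt (1 - 2 * s))"
    using assms by (subst nn_integral_cmult) (auto simp: nn_integral_std_normal_exp_square)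
  also have "\<dots> \<le> ennreal (exp (4 * s\<^sup>2))"
    using le assms by (simp add: ennreal_mult[symmetric] ennreal_leI)
  finally show ?thesis .
qed

section \<open>Independent linear forms of Gaussian coordinates and their chi-square tails\<close>

lemma indep_vars_std_normal_coordinates:
  assumes "finite I"
  shows "prob_space.indep_vars (PiM I (\<lambda>_. std_normal)) (\<lambda>_. borel) (\<lambda>i z. z i) I"
proof -
  interpret P: prob_space "PiM I (\<lambda>_. std_normal)"
    by (rule prob_space_PiM_std_normal)
  show ?thesis
  proof (cases "I = {}")
    case True
    show ?thesis
      unfolding P.indep_vars_def P.indep_sets_def using True by simp
  next
    case False
    have "distr (PiM I (\<lambda>_. std_normal)) (PiM I (\<lambda>_. borel)) (\<lambda>x. \<lambda>i\<in>I. x i)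
        = distr (PiM I (\<lambda>_. std_normal)) (PiM I (\<lambda>_. std_normal)) (\<lambda>x. x)"
      by (intro distr_cong) (auto simp: space_PiM PiE_def extensional_restrict intro!: sets_PiM_cong)
    also have "\<dots> = PiM I (\<lambda>_. std_normal)" by (rule distr_id)
    also have "\<dots> = PiM I (\<lambda>i. distr (PiM I (\<lambda>_. std_normal)) borel (\<lambda>z. z i))"
      by (intro PiM_cong) (auto simp: distr_PiM_std_normal_component assms)
    finally show ?thesis
      by (subst P.indep_vars_iff_distr_eq_PiM'[OF False]) (auto intro: borel_measurable_PiM_std_normal_component)
  qed
qed


lemma (in prob_space) distributed_sum_mult_normal:
  fixes X :: "'i \<Rightarrow> 'a \<Rightarrow> real"
  assumes fin: "finite J" and ind: "indep_vars (\<lambda>_. borel) X J"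
    and X: "\<And>i. i \<in> J \<Longrightarrow> distributed M lborel (X i) std_normal_density"
    and pos: "0 < (\<Sum>i\<in>J. (c i)\<^sup>2)"
  shows "distributed M lborel (\<lambda>x. \<Sum>i\<in>J. c i * X i x) (normal_density 0 (sqrt (\<Sum>i\<in>J. (c i)\<^sup>2)))"
proof -
  \<comment> \<open>A zero coefficient gives a point mass, which has no normal density, so only the
    nonzero coefficients are summed.\<close>
  let ?J = "{i\<in>J. c i \<noteq> 0}"
  have ne: "?J \<noteq> {}"
  proof
    assume "?J = {}"
    then have "(\<Sum>i\<in>J. (c i)\<^sup>2) = 0" by (intro sum.neutral) auto
    then show False using pos by simp
  qed
  have "indep_vars (\<lambda>_. borel) (\<lambda>i x. c i * X i x) ?J"
    using indep_vars_subset[OF ind, of ?J] by (rule indep_vars_compose2[where Y="\<lambda>i v. c i * v"]) auto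
  moreover have "distributed M lborel (\<lambda>x. c i * X i x) (normal_density 0 \<bar>c i\<bar>)" if "i \<in> ?J" for i
    using normal_density_affine[OF X, of i "c i" 0] that by simp
  ultimately have "distributed M lborel (\<lambda>x. \<Sum>i\<in>?J. c i * X i x)
      (normal_density (\<Sum>i\<in>?J. 0) (sqrt (\<Sum>i\<in>?J. \<bar>c i\<bar>\<^sup>2)))"
    using fin ne by (intro sum_indep_normal) auto
  moreover have "(\<Sum>i\<in>?J. c i * X i x) = (\<Sum>i\<in>J. c i * X i x)" for x
    by (rule sum.mono_neutral_left) (auto simp: fin)
  moreover have "(\<Sum>i\<in>?J. \<bar>c i\<bar>\<^sup>2) = (\<Sum>i\<in>J. (c i)\<^sup>2)"
    using fin by (intro sum.mono_neutral_cong_left) auto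
  ultimately show ?thesis by simp
qed

lemma PiM_std_normal_sum_mult_unit:
  assumes fin: "finite I" and JI: "J \<subseteq> I" and one: "(\<Sum>i\<in>J. (c i)\<^sup>2) = 1"
  shows "distr (PiM I (\<lambda>_. std_normal)) borel (\<lambda>z. \<Sum>i\<in>J. c i * z i) = std_normal"
proof -
  interpret P: prob_space "PiM I (\<lambda>_. std_normal)" by (rule prob_space_PiM_std_normal)
  have d: "distributed (PiM I (\<lambda>_. std_normal)) lborel (\<lambda>z. z i) std_normal_density" if "i \<in> J" for i
    using distr_PiM_std_normal_component[OF fin, of i] that JI
    by (auto simp: distributed_def std_normal_def cong: distr_cong)
  have "distributed (PiM I (\<lambda>_. std_normal)) lborel (\<lambda>z. \<Sum>i\<in>J. c i * z i) std_normal_density"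
    using P.distributed_sum_mult_normal[where X="\<lambda>i z. z i" and c=c and J=J] d
      P.indep_vars_subset[OF indep_vars_std_normal_coordinates[OF fin] JI] finite_subset[OF JI fin]
    by (simp add: one)
  then show ?thesis by (auto simp: distributed_def std_normal_def cong: distr_cong)
qed

lemma indep_vars_PiM_std_normal_block_sums:
  assumes fin: "finite I" and K: "\<And>l. l \<in> L \<Longrightarrow> K l \<subseteq> I" and dis: "disjoint_family_on K L"
  shows "prob_space.indep_vars (PiM I (\<lambda>_. std_normal)) (\<lambda>_. borel) (\<lambda>l z. \<Sum>i\<in>K l. c i * z i) L"
proof -
  interpret P: prob_space "PiM I (\<lambda>_. std_normal)" by (rule prob_space_PiM_std_normal)
  have "P.indep_vars (\<lambda>_. borel) (\<lambda>l z. \<Sum>i\<in>K l. c i * restrict z (K l) i) L"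
  proof (rule P.indep_vars_compose2[where X="\<lambda>l z. restrict z (K l)" and M'="\<lambda>l. PiM (K l) (\<lambda>_. borel)"
        and Y="\<lambda>l v. \<Sum>i\<in>K l. c i * v i"])
    show "P.indep_vars (\<lambda>l. PiM (K l) (\<lambda>_. borel)) (\<lambda>l z. restrict z (K l)) L"
      using P.indep_vars_restrict[OF indep_vars_std_normal_coordinates[OF fin] K dis] by simp
  qed measurable
  then show ?thesis by simp
qed

text \<open>Two-sided Chernoff bound: disjoint blocks with unit coefficient vectors give independent
  standard normals. It serves once with columns of the noise array as blocks and once with rows. The
  slope \<open>s\<close> stays free because the column case tunes it to \<open>n\<close> and
  \<open>d\<close>.\<close>

lemma PiM_std_normal_chi_square_tail:
  assumes fin: "finite I" "finite L" and K: "\<And>l. l \<in> L \<Longrightarrow> K l \<subseteq> I" and dis: "disjoint_family_on K L"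
    and one: "\<And>l. l \<in> L \<Longrightarrow> (\<Sum>i\<in>K l. (c i)\<^sup>2) = 1"
    and s: "0 \<le> s" "s \<le> 1 / 4"
  shows "measure (PiM I (\<lambda>_. std_normal)) {z \<in> space (PiM I (\<lambda>_. std_normal)).
      B < \<bar>(\<Sum>l\<in>L. (\<Sum>i\<in>K l. c i * z i)\<^sup>2) - real (card L)\<bar>} \<le> 2 * exp (4 * s\<^sup>2 * real (card L) - s * B)"
proof -
  let ?M = "PiM I (\<lambda>_. std_normal)"
  interpret P: prob_space ?M by (rule prob_space_PiM_std_normal)
  define Y where "Y l z = (\<Sum>i\<in>K l. c i * z i)" for l and z :: "'a \<Rightarrow> real"
  have Ym [measurable]: "Y l \<in> borel_measurable ?M" if "l \<in> L" for l
    using K[OF that] unfolding Y_def by (intro borel_measurable_sum borel_measurable_times) (auto intro: borel_measurable_PiM_std_normal_component)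
  define W where "W z = (\<Sum>l\<in>L. (Y l z)\<^sup>2) - real (card L)" for z
  have Wm [measurable]: "W \<in> borel_measurable ?M" unfolding W_def by measurable
  have mgf: "(\<integral>\<^sup>+ z. ennreal (exp (t * W z)) \<partial>?M) \<le> ennreal (exp (4 * t\<^sup>2 * real (card L)))"
    if t: "\<bar>t\<bar> \<le> 1 / 4" for t
  proof -
    have "ennreal (exp (t * W z)) = (\<Prod>l\<in>L. ennreal (exp (t * ((Y l z)\<^sup>2 - 1))))" for z
      by (simp add: W_def prod_ennreal exp_sum[symmetric] fin sum_distrib_left[symmetric] sum_subtractf)
    then have "(\<integral>\<^sup>+ z. ennreal (exp (t * W z)) \<partial>?M) = (\<integral>\<^sup>+ z. (\<Prod>l\<in>L. ennreal (exp (t * ((Y l z)\<^sup>2 - 1)))) \<partial>?M)"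
      by simp
    also have "\<dots> = (\<Prod>l\<in>L. \<integral>\<^sup>+ z. ennreal (exp (t * ((Y l z)\<^sup>2 - 1))) \<partial>?M)"
    proof (rule P.indep_vars_nn_integral[OF fin(2)])
      show "P.indep_vars (\<lambda>_. borel) (\<lambda>l z. ennreal (exp (t * ((Y l z)\<^sup>2 - 1)))) L"
        using indep_vars_PiM_std_normal_block_sums[OF fin(1) K dis, of c]
        by (intro P.indep_vars_compose2[where X=Y and M'="\<lambda>_. borel" and Y="\<lambda>_ v. ennreal (exp (t * (v\<^sup>2 - 1)))"])
          (auto simp: Y_def[abs_def])
    qed simp
    also have "\<dots> \<le> (\<Prod>l\<in>L. ennreal (exp (4 * t\<^sup>2)))"
    proof (rule prod_mono_ennreal)
      fix l assume l: "l \<in> L"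
      have "(\<integral>\<^sup>+ z. ennreal (exp (t * ((Y l z)\<^sup>2 - 1))) \<partial>?M)
          = (\<integral>\<^sup>+ v. ennreal (exp (t * (v\<^sup>2 - 1))) \<partial>distr ?M borel (Y l))"
        using Ym[OF l] by (subst nn_integral_distr) auto
      also have "distr ?M borel (Y l) = std_normal"
        unfolding Y_def by (rule PiM_std_normal_sum_mult_unit[OF fin(1) K[OF l] one[OF l]])
      finally show "(\<integral>\<^sup>+ z. ennreal (exp (t * ((Y l z)\<^sup>2 - 1))) \<partial>?M) \<le> ennreal (exp (4 * t\<^sup>2))"
        using nn_integral_std_normal_exp_centered_square_le[OF t] by simp
    qed
    also have "\<dots> = ennreal (exp (4 * t\<^sup>2 * real (card L)))"
      by (simp add: ennreal_power exp_of_nat_mult[symmetric] mult.commute)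
    finally show ?thesis .
  qed
  \<comment> \<open>Stated for \<open>t\<close> so that \<open>t = s\<close> gives the upper tail
    and \<open>t = - s\<close> the lower one.\<close>
  have half: "measure ?M {z \<in> space ?M. s * B < t * W z} \<le> exp (4 * s\<^sup>2 * real (card L) - s * B)"
    if t: "\<bar>t\<bar> \<le> 1 / 4" "t\<^sup>2 = s\<^sup>2" for t
  proof -
    have "emeasure ?M {z \<in> space ?M. s * B < t * W z}
        \<le> (\<integral>\<^sup>+ z. ennreal (exp (- (s * B))) * ennreal (exp (t * W z)) \<partial>?M)"
    proof (subst nn_integral_indicator[symmetric])
      show "{z \<in> space ?M. s * B < t * W z} \<in> sets ?M" by measurable
      show "integral\<^sup>N ?M (indicator {z \<in> space ?M. s * B < t * W z})
        \<le> (\<integral>\<^sup>+ z. ennreal (exp (- (s * B))) * ennreal (exp (t * W z)) \<partial>?M)"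
      proof (rule nn_integral_mono)
        fix z
        have "1 \<le> exp (- (s * B)) * exp (t * W z)" if "s * B < t * W z"
          using that by (simp add: exp_add[symmetric])
        then show "indicator {z \<in> space ?M. s * B < t * W z} z \<le> ennreal (exp (- (s * B))) * ennreal (exp (t * W z))"
          by (auto split: split_indicator simp: ennreal_mult[symmetric])
      qed
    qed
    also have "\<dots> = ennreal (exp (- (s * B))) * (\<integral>\<^sup>+ z. ennreal (exp (t * W z)) \<partial>?M)"
      by (rule nn_integral_cmult) measurable
    also have "\<dots> \<le> ennreal (exp (- (s * B))) * ennreal (exp (4 * t\<^sup>2 * real (card L)))"
      by (intro mult_left_mono mgf t) simp
    also have "\<dots> = ennreal (exp (4 * s\<^sup>2 * real (card L) - s * B))"
      by (simp add: t ennreal_mult[symmetric] exp_add[symmetric])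
    finally show ?thesis by (simp add: P.emeasure_eq_measure)
  qed
  show ?thesis
  \<comment> \<open>At \<open>s = 0\<close> the claimed bound is 2 and holds trivially.\<close>
  proof (cases "s = 0")
    case True
    then show ?thesis using P.prob_le_1 by (simp add: order_trans[OF P.prob_le_1])
  next
    case False
    then have s0: "0 < s" using s by simp
    have "{z \<in> space ?M. B < \<bar>(\<Sum>l\<in>L. (\<Sum>i\<in>K l. c i * z i)\<^sup>2) - real (card L)\<bar>}
      \<subseteq> {z \<in> space ?M. s * B < s * W z} \<union> {z \<in> space ?M. s * B < (- s) * W z}"
    proof safe
      fix z assume "B < \<bar>(\<Sum>l\<in>L. (\<Sum>i\<in>K l. c i * z i)\<^sup>2) - real (card L)\<bar>" "\<not> s * B < - s * W z"
      then have "B < \<bar>W z\<bar>" "\<not> s * B < s * (- W z)"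
        by (simp_all only: W_def[symmetric] Y_def[symmetric] mult_minus_left mult_minus_right not_False_eq_True)
      then have "B < W z" using s0 by (auto simp only: mult_less_cancel_left_pos)
      then show "s * B < s * W z" using s0 by simp
    qed
    then have "measure ?M {z \<in> space ?M. B < \<bar>(\<Sum>l\<in>L. (\<Sum>i\<in>K l. c i * z i)\<^sup>2) - real (card L)\<bar>}
      \<le> measure ?M ({z \<in> space ?M. s * B < s * W z} \<union> {z \<in> space ?M. s * B < (- s) * W z})"
      by (intro P.finite_measure_mono) measurable
    also have "\<dots> \<le> measure ?M {z \<in> space ?M. s * B < s * W z} + measure ?M {z \<in> space ?M. s * B < (- s) * W z}"
      by (intro measure_Un_le) measurable
    also have "\<dots> \<le> 2 * exp (4 * s\<^sup>2 * real (card L) - s * B)"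
      using half[of s] half[of "- s"] s by simp
    finally show ?thesis .
  qed
qed

section \<open>Concentration of the noise over a lattice\<close>

text \<open>For integers the square dominates the absolute value, so the terms lie below
  \<open>(1 / 2) ^ nat \<bar>j\<bar>\<close>, whose two-sided sum stays below 3. This is the cost
  per coordinate when lattice points are counted.\<close>

lemma sum_exp_neg_square_le: "(\<Sum>j\<in>{- int N..int N}. exp (- (real_of_int j)\<^sup>2)) \<le> 3"
proof -
  have le: "exp (- (real_of_int j)\<^sup>2) \<le> (1 / 2) ^ nat \<bar>j\<bar>" for j
  proof -
    have "exp (- (real_of_int j)\<^sup>2) \<le> exp (- real (nat \<bar>j\<bar>))"
    proof (cases "j = 0")
      case False
      then have "1 \<le> \<bar>real_of_int j\<bar>" by linarith
      then have "\<bar>real_of_int j\<bar> * 1 \<le> \<bar>real_of_int j\<bar> * \<bar>real_of_int j\<bar>"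
        by (intro mult_left_mono) auto
      then show ?thesis by (simp add: power2_eq_square)
    qed simp
    also have "\<dots> = exp (- 1) ^ nat \<bar>j\<bar>"
      by (simp add: exp_of_nat_mult[symmetric])
    also have "\<dots> \<le> (1 / 2) ^ nat \<bar>j\<bar>"
    proof (rule power_mono)
      show "exp (- 1) \<le> (1 / 2 :: real)"
        using exp_ge_add_one_self[of 1] by (simp add: exp_minus field_simps)
    qed simp
    finally show ?thesis .
  qed
  have "(\<Sum>j\<in>{- int N..int N}. (1 / 2 :: real) ^ nat \<bar>j\<bar>) = 3 - 2 * (1 / 2) ^ N"
  proof (induction N)
    case (Suc N)
    have "{- int (Suc N)..int (Suc N)} = insert (- int (Suc N)) (insert (int (Suc N)) {- int N..int N})"
      by auto
    moreover have "nat (1 + int N) = Suc N" "nat \<bar>- 1 - int N\<bar> = Suc N" by auto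
    ultimately show ?case using Suc by simp
  qed simp
  moreover have "(\<Sum>j\<in>{- int N..int N}. exp (- (real_of_int j)\<^sup>2))
      \<le> (\<Sum>j\<in>{- int N..int N}. (1 / 2) ^ nat \<bar>j\<bar>)"
    by (intro sum_mono le)
  moreover have "0 \<le> (1 / 2 :: real) ^ N" by simp
  ultimately show ?thesis by linarith
qed

text \<open>\<open>R\<close> is the squared radius. Extensionality pins the values outside the first
  \<open>n\<close> coordinates, which makes the set finite and a union bound possible.\<close>

definition lattice_ball :: "nat \<Rightarrow> nat \<Rightarrow> (nat \<Rightarrow> int) set" where
  "lattice_ball n R = {k \<in> extensional {..<n}. (\<Sum>i<n. (k i)\<^sup>2) \<le> int R}"

lemma lattice_ball_subset: "lattice_ball n R \<subseteq> PiE {..<n} (\<lambda>_. {- int R..int R})"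
proof
  fix k assume k: "k \<in> lattice_ball n R"
  have "\<bar>k i\<bar> \<le> int R" if "i < n" for i
  proof -
    have "\<bar>k i\<bar> \<le> (k i)\<^sup>2"
    proof (cases "k i = 0")
      case False
      then have "\<bar>k i\<bar> * 1 \<le> \<bar>k i\<bar> * \<bar>k i\<bar>" by (intro mult_left_mono) auto
      then show ?thesis by (simp add: power2_eq_square)
    qed simp
    also have "\<dots> \<le> (\<Sum>i<n. (k i)\<^sup>2)" using that by (intro member_le_sum) auto
    finally show ?thesis using k by (simp add: lattice_ball_def)
  qed
  then show "k \<in> PiE {..<n} (\<lambda>_. {- int R..int R})"
    using k unfolding lattice_ball_def PiE_iff by (simp add: abs_le_iff minus_le_iff)
qed

lemma finite_lattice_ball: "finite (lattice_ball n R)"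
  by (rule finite_subset[OF lattice_ball_subset], rule finite_PiE) auto

text \<open>Counting by an exponential weight: each point of the ball has
  \<open>exp (R - \<bar>k\<bar>\<^sup>2)\<close> at least 1, and the sum of the weights over the
  enclosing box factorizes over the coordinates.\<close>

lemma card_lattice_ball_le: "real (card (lattice_ball n R)) \<le> exp (real R) * 3 ^ n"
proof -
  let ?Q = "\<lambda>k::nat \<Rightarrow> int. \<Prod>i<n. exp (- (real_of_int (k i))\<^sup>2)"
  have "real (card (lattice_ball n R)) = (\<Sum>k\<in>lattice_ball n R. 1)" by simp
  also have "\<dots> \<le> (\<Sum>k\<in>lattice_ball n R. exp (real R) * ?Q k)"
  proof (rule sum_mono)
    fix k assume "k \<in> lattice_ball n R"
    then have "real_of_int (\<Sum>i<n. (k i)\<^sup>2) \<le> real_of_int (int R)"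
      by (subst of_int_le_iff) (simp add: lattice_ball_def)
    then have "0 \<le> real R + (\<Sum>i<n. - (real_of_int (k i))\<^sup>2)" by (simp add: sum_negf)
    then show "1 \<le> exp (real R) * ?Q k"
      by (simp add: exp_sum[symmetric] exp_add[symmetric])
  qed
  also have "\<dots> \<le> (\<Sum>k\<in>PiE {..<n} (\<lambda>_. {- int R..int R}). exp (real R) * ?Q k)"
  proof (rule sum_mono2)
    show "finite (PiE {..<n} (\<lambda>_. {- int R..int R}))" by (intro finite_PiE) auto
    show "0 \<le> exp (real R) * ?Q k" for k by (simp add: prod_nonneg)
  qed (rule lattice_ball_subset)
  also have "\<dots> = exp (real R) * (\<Prod>i<n. \<Sum>j\<in>{- int R..int R}. exp (- (real_of_int j)\<^sup>2))"
    by (subst prod_sum_PiE) (auto simp: sum_distrib_left)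
  also have "\<dots> \<le> exp (real R) * (\<Prod>i<n. 3)"
    by (intro mult_left_mono prod_mono conjI sum_nonneg sum_exp_neg_square_le) auto
  finally show ?thesis by simp
qed

text \<open>The factor 30 is large enough for the tail at one integer vector, at most
  \<open>2 * exp (- 7 * n)\<close>, to beat the fewer than \<open>exp (6 * n)\<close> integer
  vectors in the union bound.\<close>

definition noise_bound :: "nat \<Rightarrow> nat \<Rightarrow> real" where
  "noise_bound n d = 30 * (sqrt (real n * real d) + real n)"

text \<open>Integer vectors of squared norm at most \<open>4 n\<close> replace an \<open>\<epsilon>\<close>-net of the sphere:
  the hollow form is affine in each coordinate, so on the unit cube of the lattice around \<open>sqrt n * v\<close>
  with \<open>v\<close> a unit vector it is maximal at a vertex, which is such an integer vector.\<close>
definition regular_noise :: "nat \<Rightarrow> nat \<Rightarrow> (nat \<Rightarrow> real) \<Rightarrow> ((nat \<times> nat) \<Rightarrow> real) \<Rightarrow> bool" where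
  "regular_noise n d mu z \<longleftrightarrow>
     (\<forall>k::nat \<Rightarrow> int. (\<Sum>i<n. (real_of_int (k i))\<^sup>2) \<le> 4 * real n \<longrightarrow>
        \<bar>(\<Sum>l<d. (\<Sum>i<n. real_of_int (k i) * z (i, l))\<^sup>2) - real d * (\<Sum>i<n. (real_of_int (k i))\<^sup>2)\<bar>
          \<le> noise_bound n d * (\<Sum>i<n. (real_of_int (k i))\<^sup>2)) \<and>
     (\<Sum>j<n. (\<Sum>l<d. z (j, l) * mu l)\<^sup>2) \<le> 36 * real n * (\<Sum>l<d. (mu l)\<^sup>2)"

lemma borel_measurable_noise_component [measurable (raw)]:
  "i < n \<Longrightarrow> l < d \<Longrightarrow> (\<lambda>z. z (i, l)) \<in> borel_measurable (noise_space n d)"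
  unfolding noise_space_def by (rule borel_measurable_PiM_std_normal_component) auto

lemma noise_column_tail:
  assumes n: "0 < n" and d: "0 < d" and pos: "0 < (\<Sum>i<n. (c i)\<^sup>2)"
  shows "measure (noise_space n d) {z \<in> space (noise_space n d).
      noise_bound n d * (\<Sum>i<n. (c i)\<^sup>2) < \<bar>(\<Sum>l<d. (\<Sum>i<n. c i * z (i, l))\<^sup>2) - real d * (\<Sum>i<n. (c i)\<^sup>2)\<bar>}
    \<le> 2 * exp (- 7 * real n)"
proof -
  define S where "S = (\<Sum>i<n. (c i)\<^sup>2)"
  have S: "0 < S" using pos by (simp add: S_def)
  define b where "b p = c (fst p) / sqrt S" for p :: "nat \<times> nat"
  \<comment> \<open>This slope balances the two regimes of \<open>noise_bound\<close>:
    \<open>s * noise_bound n d\<close> equals \<open>7.5 * n\<close> for every \<open>d\<close>,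
    while the quadratic cost \<open>4 * s\<^sup>2 * d\<close> is at most
    \<open>n / 4\<close>.\<close>
  define s where "s = sqrt n / (4 * (sqrt n + sqrt d))"
  have dn: "0 < sqrt (real n)" "0 < sqrt (real d)" using n d by auto
  have s: "0 \<le> s" "s \<le> 1 / 4"
    using dn add_pos_pos[OF dn] by (auto simp: s_def pos_divide_le_eq)
  have sd: "s * sqrt d \<le> sqrt n / 4"
    using dn add_pos_pos[OF dn] by (auto simp: s_def pos_divide_le_eq algebra_simps)
  have "4 * s\<^sup>2 * real d = 4 * (s * sqrt d)\<^sup>2" by (simp add: power_mult_distrib)
  also have "\<dots> \<le> 4 * (sqrt n / 4)\<^sup>2" using s dn by (intro mult_left_mono power_mono sd) auto
  also have "\<dots> = real n / 4" by (simp add: power_divide)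
  finally have e1: "4 * s\<^sup>2 * real d \<le> real n / 4" .
  have nb: "noise_bound n d = 30 * sqrt n * (sqrt n + sqrt d)"
    by (simp add: noise_bound_def real_sqrt_mult algebra_simps)
  have "x / (4 * D) * (30 * x * D) = 30 / 4 * (x * x)" if "0 < D" for x D :: real
    using that by (simp add: field_simps)
  from this[OF add_pos_pos[OF dn], of "sqrt n"] have e2: "s * noise_bound n d = 30 / 4 * real n"
    unfolding nb s_def by simp
  let ?K = "\<lambda>l::nat. {..<n} \<times> {l}"
  have sumK: "(\<Sum>p\<in>?K l. f p) = (\<Sum>i<n. f (i, l))" for f :: "nat \<times> nat \<Rightarrow> real" and l
    using sum.cartesian_product[of "\<lambda>i l. f (i, l)" "{l}" "{..<n}"] by simp
  have "measure (noise_space n d) {z \<in> space (noise_space n d).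
      noise_bound n d < \<bar>(\<Sum>l\<in>{..<d}. (\<Sum>p\<in>?K l. b p * z p)\<^sup>2) - real (card {..<d})\<bar>}
    \<le> 2 * exp (4 * s\<^sup>2 * real (card {..<d}) - s * noise_bound n d)"
    unfolding noise_space_def
  proof (rule PiM_std_normal_chi_square_tail)
    show "disjoint_family_on ?K {..<d}" by (auto simp: disjoint_family_on_def)
    show "(\<Sum>p\<in>?K l. (b p)\<^sup>2) = 1" for l
      unfolding sumK using S by (simp add: b_def power_divide sum_divide_distrib[symmetric] S_def[symmetric])
  qed (use s in auto)
  also have "\<dots> \<le> 2 * exp (- 7 * real n)" using e1 e2 by simp
  finally have tail: "measure (noise_space n d) {z \<in> space (noise_space n d).
      noise_bound n d < \<bar>(\<Sum>l\<in>{..<d}. (\<Sum>p\<in>?K l. b p * z p)\<^sup>2) - real (card {..<d})\<bar>} \<le> 2 * exp (- 7 * real n)" .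
  have gen: "\<bar>A / S - D\<bar> = \<bar>A - D * S\<bar> / S" for A D
  proof -
    have "A / S - D = (A - D * S) / S" using S by (simp add: field_simps)
    then show ?thesis using S by (simp add: abs_divide)
  qed
  have eq: "(noise_bound n d < \<bar>(\<Sum>l\<in>{..<d}. (\<Sum>p\<in>?K l. b p * z p)\<^sup>2) - real (card {..<d})\<bar>)
      \<longleftrightarrow> noise_bound n d * S < \<bar>(\<Sum>l<d. (\<Sum>i<n. c i * z (i, l))\<^sup>2) - real d * S\<bar>" for z
  proof -
    have "(\<Sum>p\<in>?K l. b p * z p) = (\<Sum>i<n. c i * z (i, l)) / sqrt S" for l
      unfolding sumK by (simp add: b_def sum_divide_distrib)
    then have "(\<Sum>l\<in>{..<d}. (\<Sum>p\<in>?K l. b p * z p)\<^sup>2) = (\<Sum>l<d. (\<Sum>i<n. c i * z (i, l))\<^sup>2 / S)"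
      using S by (simp add: power_divide)
    also have "\<dots> = (\<Sum>l<d. (\<Sum>i<n. c i * z (i, l))\<^sup>2) / S" by (simp add: sum_divide_distrib)
    finally have "\<bar>(\<Sum>l\<in>{..<d}. (\<Sum>p\<in>?K l. b p * z p)\<^sup>2) - real (card {..<d})\<bar>
       = \<bar>(\<Sum>l<d. (\<Sum>i<n. c i * z (i, l))\<^sup>2) - real d * S\<bar> / S"
      using gen by simp
    then show ?thesis using S by (simp add: pos_less_divide_eq)
  qed
  show ?thesis using tail unfolding eq by (simp add: S_def)
qed

lemma noise_projection_tail:
  assumes pos: "0 < (\<Sum>l<d. (mu l)\<^sup>2)"
  shows "measure (noise_space n d) {z \<in> space (noise_space n d).
      36 * real n * (\<Sum>l<d. (mu l)\<^sup>2) < (\<Sum>j<n. (\<Sum>l<d. z (j, l) * mu l)\<^sup>2)} \<le> 2 * exp (- real n)"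
proof -
  define S where "S = (\<Sum>l<d. (mu l)\<^sup>2)"
  have S: "0 < S" using pos by (simp add: S_def)
  define b where "b p = mu (snd p) / sqrt S" for p :: "nat \<times> nat"
  let ?K = "\<lambda>j::nat. {j} \<times> {..<d}"
  have sumK: "(\<Sum>p\<in>?K j. f p) = (\<Sum>l<d. f (j, l))" for f :: "nat \<times> nat \<Rightarrow> real" and j
    using sum.cartesian_product[of "\<lambda>i l. f (i, l)" "{..<d}" "{j}"] by simp
  interpret P: prob_space "noise_space n d" unfolding noise_space_def by (rule prob_space_PiM_std_normal)
  \<comment> \<open>The normalized sum has mean \<open>n\<close>, so the threshold
    \<open>36 * n\<close> is a deviation of \<open>35 * n\<close>. At the extreme slope 1/4 the
    exponent is \<open>- 8.5 * n\<close>.\<close>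
  have tail: "measure (noise_space n d) {z \<in> space (noise_space n d).
      35 * real n < \<bar>(\<Sum>j\<in>{..<n}. (\<Sum>p\<in>?K j. b p * z p)\<^sup>2) - real (card {..<n})\<bar>}
    \<le> 2 * exp (4 * (1 / 4)\<^sup>2 * real (card {..<n}) - 1 / 4 * (35 * real n))"
    unfolding noise_space_def
  proof (rule PiM_std_normal_chi_square_tail)
    show "disjoint_family_on ?K {..<n}" by (auto simp: disjoint_family_on_def)
    show "(\<Sum>p\<in>?K j. (b p)\<^sup>2) = 1" for j
      unfolding sumK using S by (simp add: b_def power_divide sum_divide_distrib[symmetric] S_def[symmetric])
  qed auto
  have eq: "(\<Sum>j\<in>{..<n}. (\<Sum>p\<in>?K j. b p * z p)\<^sup>2) = (\<Sum>j<n. (\<Sum>l<d. z (j, l) * mu l)\<^sup>2) / S" for z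
  proof -
    have "(\<Sum>p\<in>?K j. b p * z p) = (\<Sum>l<d. z (j, l) * mu l) / sqrt S" for j
      unfolding sumK by (simp add: b_def sum_divide_distrib mult.commute)
    then have "(\<Sum>j\<in>{..<n}. (\<Sum>p\<in>?K j. b p * z p)\<^sup>2) = (\<Sum>j<n. (\<Sum>l<d. z (j, l) * mu l)\<^sup>2 / S)"
      using S by (simp add: power_divide)
    then show ?thesis by (simp add: sum_divide_distrib)
  qed
  have "{z \<in> space (noise_space n d). 36 * real n * S < (\<Sum>j<n. (\<Sum>l<d. z (j, l) * mu l)\<^sup>2)}
    \<subseteq> {z \<in> space (noise_space n d).
      35 * real n < \<bar>(\<Sum>j\<in>{..<n}. (\<Sum>p\<in>?K j. b p * z p)\<^sup>2) - real (card {..<n})\<bar>}"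
    unfolding eq using S by (auto simp: field_simps)
  then have "measure (noise_space n d) {z \<in> space (noise_space n d). 36 * real n * S < (\<Sum>j<n. (\<Sum>l<d. z (j, l) * mu l)\<^sup>2)}
    \<le> measure (noise_space n d) {z \<in> space (noise_space n d).
      35 * real n < \<bar>(\<Sum>j\<in>{..<n}. (\<Sum>p\<in>?K j. b p * z p)\<^sup>2) - real (card {..<n})\<bar>}"
    by (rule P.finite_measure_mono) (unfold eq, measurable)
  also note tail
  also have "2 * exp (4 * (1 / 4)\<^sup>2 * real (card {..<n}) - 1 / 4 * (35 * real n)) \<le> 2 * exp (- real n)"
    by (simp add: power2_eq_square)
  finally show ?thesis by (simp add: S_def)
qed

text \<open>\<open>regular_noise\<close> quantifies over all integer-valued functions, but only
  their first \<open>n\<close> values matter. The finitely many vectors of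
  \<open>lattice_ball n (4 * n)\<close> therefore suffice, and \<open>Bad\<close> is a measurable
  set outside which regularity holds.\<close>

lemma regular_noise_prob:
  assumes n: "0 < n" and d: "0 < d" and pos: "0 < (\<Sum>l<d. (mu l)\<^sup>2)"
  obtains Bad where "Bad \<in> sets (noise_space n d)" "measure (noise_space n d) Bad \<le> 4 * exp (- real n)"
    "\<And>z. z \<in> space (noise_space n d) - Bad \<Longrightarrow> regular_noise n d mu z"
proof
  let ?M = "noise_space n d"
  let ?S = "\<lambda>k::nat \<Rightarrow> int. \<Sum>i<n. (real_of_int (k i))\<^sup>2"
  interpret P: prob_space ?M unfolding noise_space_def by (rule prob_space_PiM_std_normal)
  define A where "A k = {z \<in> space ?M. noise_bound n d * ?S k
     < \<bar>(\<Sum>l<d. (\<Sum>i<n. real_of_int (k i) * z (i, l))\<^sup>2) - real d * ?S k\<bar>}" for k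
  define C where "C = {z \<in> space ?M. 36 * real n * (\<Sum>l<d. (mu l)\<^sup>2) < (\<Sum>j<n. (\<Sum>l<d. z (j, l) * mu l)\<^sup>2)}"
  have Am: "A k \<in> sets ?M" for k unfolding A_def by measurable
  have Cm: "C \<in> sets ?M" unfolding C_def by measurable
  have PA: "measure ?M (A k) \<le> 2 * exp (- 7 * real n)" for k
  \<comment> \<open>The zero vector cannot be normalized for the tail bound; its event is empty
    because the defining inequality is strict.\<close>
  proof (cases "?S k = 0")
    case True
    then have "k i = 0" if "i < n" for i using that by (simp add: sum_nonneg_eq_0_iff)
    then have "A k = {}" using True by (auto simp: A_def)
    then show ?thesis by simp
  next
    case False
    then have "0 < ?S k" by (simp add: less_le sum_nonneg)
    then show ?thesis unfolding A_def by (rule noise_column_tail[OF n d])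
  qed
  let ?Bad = "(\<Union>k\<in>lattice_ball n (4 * n). A k) \<union> C"
  show "?Bad \<in> sets ?M" using Am Cm finite_lattice_ball by (auto intro!: sets.finite_UN)
  have "measure ?M (\<Union>k\<in>lattice_ball n (4 * n). A k) \<le> (\<Sum>k\<in>lattice_ball n (4 * n). measure ?M (A k))"
    using Am finite_lattice_ball by (intro measure_UNION_le) auto
  also have "\<dots> \<le> (\<Sum>k\<in>lattice_ball n (4 * n). 2 * exp (- 7 * real n))"
    by (intro sum_mono PA)
  also have "\<dots> = real (card (lattice_ball n (4 * n))) * (2 * exp (- 7 * real n))" by simp
  also have "\<dots> \<le> (exp (real (4 * n)) * 3 ^ n) * (2 * exp (- 7 * real n))"
    by (intro mult_right_mono card_lattice_ball_le) simp
  \<comment> \<open>Balance of exponents: 4 from the radius, 2 from the factor 3 per coordinate, and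
    -7 from the tail leave -1.\<close>
  also have "\<dots> \<le> (exp (real (4 * n)) * exp (2 * real n)) * (2 * exp (- 7 * real n))"
  proof (intro mult_right_mono mult_left_mono)
    have "(3::real) \<le> exp 2" using exp_ge_add_one_self[of 2] by simp
    then have "(3::real) ^ n \<le> exp 2 ^ n" by (intro power_mono) auto
    then show "(3::real) ^ n \<le> exp (2 * real n)" by (simp add: exp_of_nat_mult[symmetric] mult.commute)
  qed auto
  also have "\<dots> = 2 * exp (- real n)" by (simp add: exp_add[symmetric])
  finally have 1: "measure ?M (\<Union>k\<in>lattice_ball n (4 * n). A k) \<le> 2 * exp (- real n)" .
  have 2: "measure ?M C \<le> 2 * exp (- real n)"
    unfolding C_def by (rule noise_projection_tail[OF pos])
  have "measure ?M ?Bad \<le> measure ?M (\<Union>k\<in>lattice_ball n (4 * n). A k) + measure ?M C"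
    using Am Cm finite_lattice_ball by (intro measure_Un_le) (auto intro!: sets.finite_UN)
  then show "measure ?M ?Bad \<le> 4 * exp (- real n)" using 1 2 by simp
  show "regular_noise n d mu z" if z: "z \<in> space ?M - ?Bad" for z
    unfolding regular_noise_def
  proof (intro conjI allI impI)
    fix k :: "nat \<Rightarrow> int" assume k: "?S k \<le> 4 * real n"
    define k' where "k' = restrict k {..<n}"
    have "real_of_int (\<Sum>i<n. (k i)\<^sup>2) \<le> real_of_int (int (4 * n))" using k by simp
    then have "(\<Sum>i<n. (k i)\<^sup>2) \<le> int (4 * n)" by (subst (asm) of_int_le_iff)
    then have "k' \<in> lattice_ball n (4 * n)" by (simp add: lattice_ball_def k'_def)
    then have "z \<notin> A k'" using z by auto
    moreover have "?S k' = ?S k" "(\<Sum>i<n. real_of_int (k' i) * z (i, l)) = (\<Sum>i<n. real_of_int (k i) * z (i, l))" for l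
      by (auto simp: k'_def)
    ultimately show "\<bar>(\<Sum>l<d. (\<Sum>i<n. real_of_int (k i) * z (i, l))\<^sup>2) - real d * ?S k\<bar> \<le> noise_bound n d * ?S k"
      using z by (simp add: A_def)
  next
    show "(\<Sum>j<n. (\<Sum>l<d. z (j, l) * mu l)\<^sup>2) \<le> 36 * real n * (\<Sum>l<d. (mu l)\<^sup>2)"
      using z by (auto simp: C_def)
  qed
qed

section \<open>Gaussian tail of a single noise row\<close>

lemma std_normal_tail:
  assumes "0 \<le> \<kappa>"
  shows "emeasure std_normal {x. \<kappa> \<le> \<bar>x\<bar>} \<le> ennreal (2 * exp (- (\<kappa>\<^sup>2 / 2)))"
proof -
  have "emeasure std_normal {x. \<kappa> \<le> \<bar>x\<bar>} = (\<integral>\<^sup>+ x. indicator {x. \<kappa> \<le> \<bar>x\<bar>} x \<partial>std_normal)"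
    by (subst nn_integral_indicator) auto
  also have "\<dots> \<le> (\<integral>\<^sup>+ x. ennreal (exp (- \<kappa>\<^sup>2)) * (ennreal (exp (\<kappa> * x)) + ennreal (exp (- \<kappa> * x))) \<partial>std_normal)"
  proof (rule nn_integral_mono)
    fix x
    have "1 \<le> exp (- \<kappa>\<^sup>2) * (exp (\<kappa> * x) + exp (- \<kappa> * x))" if "\<kappa> \<le> \<bar>x\<bar>"
    proof -
      have "\<kappa>\<^sup>2 \<le> \<kappa> * \<bar>x\<bar>"
        unfolding power2_eq_square using assms that by (intro mult_left_mono)
      then have "1 \<le> exp (- \<kappa>\<^sup>2) * exp (\<kappa> * \<bar>x\<bar>)" by (simp add: exp_add[symmetric])
      also have "\<dots> \<le> exp (- \<kappa>\<^sup>2) * (exp (\<kappa> * x) + exp (- \<kappa> * x))"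
        by (intro mult_left_mono) (auto simp: abs_if)
      finally show ?thesis .
    qed
    then show "indicator {x. \<kappa> \<le> \<bar>x\<bar>} x \<le> ennreal (exp (- \<kappa>\<^sup>2)) * (ennreal (exp (\<kappa> * x)) + ennreal (exp (- \<kappa> * x)))"
      by (auto split: split_indicator simp: ennreal_mult[symmetric] ennreal_plus[symmetric] simp del: ennreal_plus)
  qed
  also have "\<dots> = ennreal (exp (- \<kappa>\<^sup>2)) * (ennreal (exp (\<kappa>\<^sup>2 / 2)) + ennreal (exp ((- \<kappa>)\<^sup>2 / 2)))"
    unfolding nn_integral_std_normal_exp_linear[symmetric]
    by (subst nn_integral_cmult, simp, subst nn_integral_add, simp, simp, rule refl)
  also have "\<dots> = ennreal (2 * exp (- (\<kappa>\<^sup>2 / 2)))"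
  proof -
    have "exp (- \<kappa>\<^sup>2) * (exp (\<kappa>\<^sup>2 / 2) + exp (\<kappa>\<^sup>2 / 2)) = 2 * exp (- (\<kappa>\<^sup>2 / 2))"
      by (simp add: algebra_simps exp_add[symmetric])
    then show ?thesis by (simp add: ennreal_mult[symmetric] ennreal_plus[symmetric] del: ennreal_plus)
  qed
  finally show ?thesis .
qed

text \<open>Fubini: with all rows but \<open>i\<close> frozen, \<open>q\<close> is a constant vector
  and its normalized inner product with row \<open>i\<close> is a standard normal. The condition of
  positive length excludes \<open>q = 0\<close>, where the second inequality would hold
  trivially.\<close>

lemma noise_row_tail:
  fixes q :: "((nat \<times> nat) \<Rightarrow> real) \<Rightarrow> nat \<Rightarrow> real"
  assumes i: "i < n" and \<kappa>: "0 \<le> \<kappa>"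
    and qm [measurable]: "\<And>l. l < d \<Longrightarrow> (\<lambda>z. q z l) \<in> borel_measurable (noise_space n d)"
    and q: "\<And>z z'. z \<in> space (noise_space n d) \<Longrightarrow> z' \<in> space (noise_space n d) \<Longrightarrow>
        (\<And>j l. j < n \<Longrightarrow> j \<noteq> i \<Longrightarrow> l < d \<Longrightarrow> z (j, l) = z' (j, l)) \<Longrightarrow> q z = q z'"
  shows "measure (noise_space n d) {z \<in> space (noise_space n d).
      0 < (\<Sum>l<d. (q z l)\<^sup>2) \<and> \<kappa> * sqrt (\<Sum>l<d. (q z l)\<^sup>2) \<le> \<bar>\<Sum>l<d. z (i, l) * q z l\<bar>}
    \<le> 2 * exp (- (\<kappa>\<^sup>2 / 2))"
proof -
  define I where "I = ({..<n} - {i}) \<times> {..<d}"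
  define J where "J = {i} \<times> {..<d}"
  have IJ: "I \<inter> J = {}" "finite I" "finite J" "I \<union> J = {..<n} \<times> {..<d}"
    using i by (auto simp: I_def J_def)
  have M: "noise_space n d = PiM (I \<union> J) (\<lambda>_. std_normal)"
    by (simp add: IJ noise_space_def)
  interpret P: prob_space "noise_space n d" unfolding noise_space_def by (rule prob_space_PiM_std_normal)
  interpret prod: product_sigma_finite "\<lambda>_::nat \<times> nat. std_normal"
    by (rule product_sigma_finite_std_normal)
  define A where "A = {z \<in> space (noise_space n d).
      0 < (\<Sum>l<d. (q z l)\<^sup>2) \<and> \<kappa> * sqrt (\<Sum>l<d. (q z l)\<^sup>2) \<le> \<bar>\<Sum>l<d. z (i, l) * q z l\<bar>}"
  have Am: "A \<in> sets (noise_space n d)" 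
  proof -
    define f where "f z = (\<Sum>l<d. z (i, l) * q z l)" for z
    have [measurable]: "f \<in> borel_measurable (noise_space n d)"
      unfolding f_def using i by (intro borel_measurable_sum borel_measurable_times borel_measurable_noise_component qm) auto
    define g where "g z = (\<Sum>l<d. (q z l)\<^sup>2)" for z
    have [measurable]: "g \<in> borel_measurable (noise_space n d)"
      unfolding g_def by measurable
    have "(\<lambda>z. \<kappa> * sqrt (g z)) \<in> borel_measurable (noise_space n d)" "(\<lambda>z. \<bar>f z\<bar>) \<in> borel_measurable (noise_space n d)"
      by measurable
    from borel_measurable_le[OF this] have "{z \<in> space (noise_space n d). \<kappa> * sqrt (g z) \<le> \<bar>f z\<bar>} \<in> sets (noise_space n d)" .
    then show ?thesis unfolding A_def f_def[symmetric] g_def[symmetric]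
      by (intro sets.sets_Collect_conj) measurable
  qed
  have inner: "(\<integral>\<^sup>+ v. indicator A (merge I J (x, v)) \<partial>PiM J (\<lambda>_. std_normal)) \<le> ennreal (2 * exp (- (\<kappa>\<^sup>2 / 2)))"
    if x: "x \<in> space (PiM I (\<lambda>_. std_normal))" for x
  proof -
    have mspace: "merge I J (x, v) \<in> space (noise_space n d)" if "v \<in> space (PiM J (\<lambda>_. std_normal))" for v
      unfolding M by (auto simp: space_PiM PiE_def extensional_def merge_def)
    \<comment> \<open>Row \<open>i\<close> is filled with zeros only to have a representative: by
      hypothesis \<open>q\<close> takes the same value for every other filling.\<close>
    define b where "b = q (merge I J (x, restrict (\<lambda>_. 0) J))"
    have qb: "q (merge I J (x, v)) = b" if "v \<in> space (PiM J (\<lambda>_. std_normal))" for v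
      unfolding b_def
    proof (rule q)
      show "merge I J (x, v) \<in> space (noise_space n d)" by (rule mspace[OF that])
      show "merge I J (x, restrict (\<lambda>_. 0) J) \<in> space (noise_space n d)"
        by (rule mspace) (simp add: space_PiM)
    qed (simp add: merge_def I_def)
    define S where "S = (\<Sum>l<d. (b l)\<^sup>2)"
    show ?thesis
    proof (cases "0 < S")
      case False
      have "(\<integral>\<^sup>+ v. indicator A (merge I J (x, v)) \<partial>PiM J (\<lambda>_. std_normal)) = (\<integral>\<^sup>+ v. 0 \<partial>PiM J (\<lambda>_. std_normal))"
        by (rule nn_integral_cong) (use False in \<open>simp add: A_def qb S_def indicator_def\<close>)
      then show ?thesis by simp
    next
      case True
      define c where "c p = b (snd p) / sqrt S" for p :: "nat \<times> nat"
      have sumJ: "(\<Sum>p\<in>J. f p) = (\<Sum>l<d. f (i, l))" for f :: "nat \<times> nat \<Rightarrow> real"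
        unfolding J_def using sum.cartesian_product[of "\<lambda>i l. f (i, l)" "{..<d}" "{i}"] by simp
      have one: "(\<Sum>p\<in>J. (c p)\<^sup>2) = 1"
        unfolding sumJ using True by (simp add: c_def power_divide sum_divide_distrib[symmetric] S_def[symmetric])
      have lin [measurable]: "(\<lambda>v. \<Sum>p\<in>J. c p * v p) \<in> borel_measurable (PiM J (\<lambda>_. std_normal))"
        by (intro borel_measurable_sum borel_measurable_times borel_measurable_PiM_std_normal_component) auto
      have "(\<integral>\<^sup>+ v. indicator A (merge I J (x, v)) \<partial>PiM J (\<lambda>_. std_normal))
          \<le> (\<integral>\<^sup>+ v. indicator {r. \<kappa> \<le> \<bar>r\<bar>} (\<Sum>p\<in>J. c p * v p) \<partial>PiM J (\<lambda>_. std_normal))"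
      proof (rule nn_integral_mono)
        fix v assume v: "v \<in> space (PiM J (\<lambda>_. std_normal))"
        have "\<kappa> \<le> \<bar>\<Sum>p\<in>J. c p * v p\<bar>" if a: "merge I J (x, v) \<in> A"
        proof -
          have mv: "merge I J (x, v) (i, l) = v (i, l)" if "l < d" for l
            using that by (simp add: merge_def I_def J_def)
          have "\<kappa> * sqrt S \<le> \<bar>\<Sum>l<d. v (i, l) * b l\<bar>"
            using a mv by (simp add: A_def qb[OF v] S_def)
          moreover have "(\<Sum>p\<in>J. c p * v p) = (\<Sum>l<d. v (i, l) * b l) / sqrt S"
            unfolding sumJ by (simp add: c_def sum_divide_distrib mult.commute)
          ultimately show ?thesis using True by (simp add: abs_divide pos_le_divide_eq)
        qed
        then show "indicator A (merge I J (x, v)) \<le> (indicator {r. \<kappa> \<le> \<bar>r\<bar>} (\<Sum>p\<in>J. c p * v p) :: ennreal)"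
          by (auto split: split_indicator)
      qed
      also have "\<dots> = (\<integral>\<^sup>+ r. indicator {r. \<kappa> \<le> \<bar>r\<bar>} r \<partial>distr (PiM J (\<lambda>_. std_normal)) borel (\<lambda>v. \<Sum>p\<in>J. c p * v p))"
        by (subst nn_integral_distr) auto
      also have "\<dots> = emeasure std_normal {r. \<kappa> \<le> \<bar>r\<bar>}"
        using PiM_std_normal_sum_mult_unit[OF IJ(3) subset_refl one] by simp
      also have "\<dots> \<le> ennreal (2 * exp (- (\<kappa>\<^sup>2 / 2)))"
        by (rule std_normal_tail[OF \<kappa>])
      finally show ?thesis .
    qed
  qed
  have "emeasure (noise_space n d) A = (\<integral>\<^sup>+ z. indicator A z \<partial>PiM (I \<union> J) (\<lambda>_. std_normal))"
    using Am by (simp add: M)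
  also have "\<dots> = (\<integral>\<^sup>+ x. (\<integral>\<^sup>+ v. indicator A (merge I J (x, v)) \<partial>PiM J (\<lambda>_. std_normal)) \<partial>PiM I (\<lambda>_. std_normal))"
    by (rule prod.product_nn_integral_fold[OF IJ(1-3)]) (use Am in \<open>simp add: M\<close>)
  also have "\<dots> \<le> (\<integral>\<^sup>+ x. ennreal (2 * exp (- (\<kappa>\<^sup>2 / 2))) \<partial>PiM I (\<lambda>_. std_normal))"
    by (rule nn_integral_mono) (rule inner)
  also have "\<dots> = ennreal (2 * exp (- (\<kappa>\<^sup>2 / 2)))"
    using prob_space.emeasure_space_1[OF prob_space_PiM_std_normal, of I] by simp
  finally show ?thesis
    unfolding A_def[symmetric] by (simp add: P.emeasure_eq_measure)
qed

section \<open>Quadratic forms and leading eigenvectors\<close>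

definition quad_form :: "nat \<Rightarrow> (nat \<Rightarrow> nat \<Rightarrow> real) \<Rightarrow> (nat \<Rightarrow> real) \<Rightarrow> real" where
  "quad_form n G v = (\<Sum>i<n. \<Sum>j<n. G i j * v i * v j)"

lemma quad_form_scale: "quad_form n G (\<lambda>i. c * v i) = c\<^sup>2 * quad_form n G v"
  by (simp add: quad_form_def sum_distrib_left power2_eq_square mult.assoc mult.left_commute)

lemma quad_form_add_coord:
  assumes sym: "\<And>j k. j < n \<Longrightarrow> k < n \<Longrightarrow> G j k = G k j" and i: "i < n"
  shows "quad_form n G (v(i := v i + t)) = quad_form n G v + 2 * t * (\<Sum>j<n. G i j * v j) + t\<^sup>2 * G i i"
proof -
  define e where "e j = (if j = i then 1 else 0 :: real)" for j
  have v: "v(i := v i + t) = (\<lambda>j. v j + t * e j)" by (auto simp: e_def)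
  have d1: "(\<Sum>j<n. f j * e j) = f i" for f :: "nat \<Rightarrow> real"
    using i by (simp add: e_def if_distrib[of "\<lambda>x. _ * x"] cong: if_cong)
  have "quad_form n G (v(i := v i + t)) = quad_form n G v
      + t * (\<Sum>k<n. \<Sum>j<n. G k j * v k * e j) + t * (\<Sum>k<n. \<Sum>j<n. G k j * e k * v j)
      + t\<^sup>2 * (\<Sum>k<n. \<Sum>j<n. G k j * e k * e j)"
    unfolding v quad_form_def
    by (simp add: sum_distrib_left sum.distrib[symmetric] algebra_simps power2_eq_square)
  also have "(\<Sum>k<n. \<Sum>j<n. G k j * v k * e j) = (\<Sum>j<n. G i j * v j)"
    unfolding d1 by (intro sum.cong) (auto simp: sym i)
  also have "(\<Sum>k<n. \<Sum>j<n. G k j * e k * v j) = (\<Sum>j<n. \<Sum>k<n. (G k j * v j) * e k)"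
    by (subst sum.swap) (simp add: mult_ac)
  also have "\<dots> = (\<Sum>j<n. G i j * v j)" unfolding d1 ..
  also have "(\<Sum>k<n. \<Sum>j<n. G k j * e k * e j) = G i i" unfolding d1 ..
  finally show ?thesis by linarith
qed

lemma sum_squares_add_coord:
  fixes v :: "nat \<Rightarrow> real"
  assumes i: "i < n"
  shows "(\<Sum>j<n. ((v(i := v i + t)) j)\<^sup>2) = (\<Sum>j<n. (v j)\<^sup>2) + 2 * t * v i + (t::real)\<^sup>2"
proof -
  have s: "(\<Sum>j<n. f j) = f i + (\<Sum>j\<in>{..<n} - {i}. f j)" for f :: "nat \<Rightarrow> real"
    using i by (simp add: sum.remove)
  have "(\<Sum>j\<in>{..<n} - {i}. ((v(i := v i + t)) j)\<^sup>2) = (\<Sum>j\<in>{..<n} - {i}. (v j)\<^sup>2)"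
    by (intro sum.cong) auto
  then show ?thesis unfolding s[of "\<lambda>j. ((v(i := v i + t)) j)\<^sup>2"] s[of "\<lambda>j. (v j)\<^sup>2"]
    by (simp add: power2_eq_square algebra_simps)
qed

text \<open>First-order condition at a maximum, without derivatives: \<open>t = a / D\<close> with
  \<open>D\<close> larger than |b| makes the linear term win unless \<open>a\<close>
  vanishes.\<close>

lemma linear_le_quadratic_imp_zero:
  fixes a b :: real
  assumes "\<And>t. 2 * t * a \<le> t\<^sup>2 * b"
  shows "a = 0"
proof (rule ccontr)
  assume "a \<noteq> 0"
  define D where "D = \<bar>b\<bar> + 1"
  have D: "0 < D" by (simp add: D_def)
  have "2 * (a / D) * a \<le> (a / D)\<^sup>2 * b" by (rule assms)
  then have "a\<^sup>2 * (2 * D) \<le> a\<^sup>2 * b"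
    using D by (simp add: field_simps power2_eq_square)
  then have "2 * D \<le> b" using \<open>a \<noteq> 0\<close> by simp
  then show False by (simp add: D_def)
qed

text \<open>Perturbing the maximizer in coordinate \<open>i\<close> by \<open>t\<close> leaves an
  inequality between a term linear in \<open>t\<close> and one quadratic in \<open>t\<close>; the
  linear coefficient is the defect of the \<open>i\<close>-th eigenvector equation.\<close>

lemma quad_form_maximizer_eigen:
  assumes sym: "\<And>j k. j < n \<Longrightarrow> k < n \<Longrightarrow> G j k = G k j"
    and le: "\<And>w. quad_form n G w \<le> L * (\<Sum>j<n. (w j)\<^sup>2)"
    and eq: "quad_form n G v = L * (\<Sum>j<n. (v j)\<^sup>2)" and i: "i < n"
  shows "(\<Sum>j<n. G i j * v j) = L * v i"
proof -
  have "2 * t * ((\<Sum>j<n. G i j * v j) - L * v i) \<le> t\<^sup>2 * (L - G i i)" for t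
  proof -
    have "quad_form n G (v(i := v i + t)) = quad_form n G v + 2 * t * (\<Sum>j<n. G i j * v j) + t\<^sup>2 * G i i"
      by (rule quad_form_add_coord[OF sym i])
    then show ?thesis
      using le[of "v(i := v i + t)"] unfolding sum_squares_add_coord[OF i] eq by (simp only: algebra_simps)
  qed
  from linear_le_quadratic_imp_zero[OF this] show ?thesis by simp
qed

lemma quad_form_max_exists:
  assumes n: "0 < n"
  obtains v :: "nat \<Rightarrow> real" where "(\<Sum>i<n. (v i)\<^sup>2) = 1" "\<And>w. quad_form n G w \<le> quad_form n G v * (\<Sum>i<n. (w i)\<^sup>2)"
proof -
  \<comment> \<open>Vectors are functions on all of \<open>nat\<close>. Freezing the coordinates
    from \<open>n\<close> on at 0 makes the cube compact in the product topology, and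
    \<open>quad_form\<close> does not see those coordinates.\<close>
  define C where "C = PiE UNIV (\<lambda>i::nat. if i < n then {-1..1::real} else {0})"
  define K where "K = C \<inter> {v. (\<Sum>i<n. (v i)\<^sup>2) = 1}"
  have "compactin (product_topology (\<lambda>i. euclidean) UNIV) C"
    unfolding C_def compactin_PiE by auto
  then have C: "compact C"
    by (simp add: euclidean_product_topology)
  have coord: "continuous_on UNIV (\<lambda>v::nat \<Rightarrow> real. v i)" for i
    by (rule continuous_on_product_coordinates)
  have "closed {v::nat \<Rightarrow> real. (\<Sum>i<n. (v i)\<^sup>2) = 1}"
    by (intro closed_Collect_eq continuous_intros coord)
  with C have K: "compact K" unfolding K_def by (rule compact_Int_closed)
  have "(\<lambda>i. if i = 0 then 1 else 0) \<in> K"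
    using n by (auto simp: K_def C_def if_distrib[of "\<lambda>x. x\<^sup>2"] cong: if_cong)
  then have ne: "K \<noteq> {}" by blast
  have "continuous_on K (quad_form n G)"
    unfolding quad_form_def
    by (intro continuous_intros continuous_on_subset[OF coord]) auto
  from continuous_attains_sup[OF K ne this] obtain v
    where v: "v \<in> K" and max: "\<And>w. w \<in> K \<Longrightarrow> quad_form n G w \<le> quad_form n G v" by blast
  show thesis
  proof
    show "(\<Sum>i<n. (v i)\<^sup>2) = 1" using v by (simp add: K_def)
    fix w :: "nat \<Rightarrow> real"
    define S where "S = (\<Sum>i<n. (w i)\<^sup>2)"
    show "quad_form n G w \<le> quad_form n G v * (\<Sum>i<n. (w i)\<^sup>2)"
    proof (cases "S = 0")
      case True
      then have "w i = 0" if "i < n" for i using that by (simp add: S_def sum_nonneg_eq_0_iff)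
      then have "quad_form n G w = 0" by (simp add: quad_form_def)
      then show ?thesis using True by (simp add: S_def)
    next
      case False
      then have S: "0 < S" by (simp add: S_def less_le sum_nonneg)
      define x where "x i = (if i < n then w i / sqrt S else 0)" for i
      have x1: "(\<Sum>i<n. (x i)\<^sup>2) = 1"
        using S by (simp add: x_def power_divide sum_divide_distrib[symmetric] S_def[symmetric])
      have "\<bar>x i\<bar> \<le> 1" if "i < n" for i
      proof -
        have "(x i)\<^sup>2 \<le> (\<Sum>i<n. (x i)\<^sup>2)" using that by (intro member_le_sum) auto
        then show ?thesis using x1 by (simp add: abs_square_le_1)
      qed
      then have "x i \<in> (if i < n then {-1..1} else {0})" for i
        by (cases "i < n") (auto simp: abs_le_iff minus_le_iff, simp add: x_def)
      then have "x \<in> K" using x1 by (simp add: K_def C_def PiE_UNIV_domain)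
      then have "quad_form n G x \<le> quad_form n G v" by (rule max)
      moreover have "quad_form n G w = S * quad_form n G x"
      proof -
        have "quad_form n G w = quad_form n G (\<lambda>i. sqrt S * x i)"
          unfolding quad_form_def using S by (intro sum.cong) (auto simp: x_def)
        then show ?thesis using S by (simp add: quad_form_scale)
      qed
      ultimately show ?thesis using S by (simp add: S_def[symmetric] mult.commute)
    qed
  qed
qed

text \<open>\<open>leading_unit_eigvec\<close> compares \<open>lam\<close> only with other
  eigenvalues. The maximum of the form on the sphere is attained at an eigenvector, so it is itself
  an eigenvalue; hence \<open>lam\<close> bounds every Rayleigh quotient.\<close>

lemma leading_unit_eigvec_rayleigh:
  fixes u :: "real vec"
  assumes lead: "leading_unit_eigvec (mat n n (\<lambda>(i, j). G i j)) u"
    and sym: "\<And>j k. j < n \<Longrightarrow> k < n \<Longrightarrow> G j k = G k j"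
  obtains lam where "(\<Sum>i<n. (u $ i)\<^sup>2) = 1"
    "\<And>i. i < n \<Longrightarrow> (\<Sum>j<n. G i j * u $ j) = lam * u $ i"
    "\<And>w. quad_form n G w \<le> lam * (\<Sum>j<n. (w j)\<^sup>2)"
    "quad_form n G (\<lambda>i. u $ i) = lam"
proof -
  let ?A = "mat n n (\<lambda>(i, j). G i j)"
  obtain lam where ev: "eigenvector ?A u lam" and top: "\<And>m. eigenvalue ?A m \<Longrightarrow> m \<le> lam"
    and uu: "u \<bullet> u = 1"
    using lead by (auto simp: leading_unit_eigvec_def)
  have dim: "dim_vec u = n" using ev by (auto simp: eigenvector_def)
  have one: "(\<Sum>i<n. (u $ i)\<^sup>2) = 1"
    using uu by (simp add: scalar_prod_def dim power2_eq_square atLeast0LessThan)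
  then have n: "0 < n" by (cases n) auto
  have eq: "(\<Sum>j<n. G i j * u $ j) = lam * u $ i" if "i < n" for i
  proof -
    have "(?A *\<^sub>v u) $ i = (lam \<cdot>\<^sub>v u) $ i" using ev by (simp add: eigenvector_def)
    then show ?thesis using that dim by (simp add: scalar_prod_def atLeast0LessThan)
  qed
  obtain v where v1: "(\<Sum>i<n. (v i)\<^sup>2) = 1"
    and vmax: "\<And>w. quad_form n G w \<le> quad_form n G v * (\<Sum>i<n. (w i)\<^sup>2)"
    using quad_form_max_exists[OF n] by blast
  have veig: "(\<Sum>j<n. G i j * v j) = quad_form n G v * v i" if "i < n" for i
    by (rule quad_form_maximizer_eigen[OF sym vmax _ that]) (auto simp: v1)
  have "eigenvector ?A (vec n v) (quad_form n G v)"
    unfolding eigenvector_def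
  proof (intro conjI)
    show "vec n v \<noteq> 0\<^sub>v (dim_row ?A)"
    proof
      assume "vec n v = 0\<^sub>v (dim_row ?A)"
      then have "v i = 0" if "i < n" for i
        using that by (metis dim_row_mat(1) index_vec index_zero_vec(1))
      then show False using v1 by simp
    qed
    show "?A *\<^sub>v vec n v = quad_form n G v \<cdot>\<^sub>v vec n v"
      by (rule eq_vecI) (auto simp: scalar_prod_def atLeast0LessThan veig)
  qed simp
  then have le: "quad_form n G v \<le> lam" by (intro top) (auto simp: eigenvalue_def)
  have ray: "quad_form n G w \<le> lam * (\<Sum>j<n. (w j)\<^sup>2)" for w
    by (rule order_trans[OF vmax mult_right_mono[OF le]]) (simp add: sum_nonneg)
  have "quad_form n G (\<lambda>i. u $ i) = (\<Sum>i<n. u $ i * (\<Sum>j<n. G i j * u $ j))"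
    unfolding quad_form_def by (simp add: sum_distrib_left mult_ac)
  also have "\<dots> = (\<Sum>i<n. lam * (u $ i)\<^sup>2)"
    by (intro sum.cong) (auto simp: eq power2_eq_square)
  also have "\<dots> = lam" by (simp add: sum_distrib_left[symmetric] one)
  finally show thesis using that[OF one eq ray] by simp
qed

text \<open>Row \<open>i\<close> of the reduced matrix is zero, so \<open>lam' > 0\<close> forces
  \<open>u' i = 0\<close>. Then \<open>G\<close> maps \<open>u'\<close> to \<open>lam' * u'\<close>
  plus a multiple \<open>c\<close> of the \<open>i\<close>-th unit vector, and pairing with
  \<open>u\<close> by symmetry gives the identity.\<close>

lemma leave_one_out_identity:
  fixes u u' :: "nat \<Rightarrow> real"
  assumes sym: "\<And>j k. j < n \<Longrightarrow> k < n \<Longrightarrow> G j k = G k j" and i: "i < n"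
    and eq: "\<And>j. j < n \<Longrightarrow> (\<Sum>k<n. G j k * u k) = lam * u j"
    and ray: "\<And>w. quad_form n G w \<le> lam * (\<Sum>j<n. (w j)\<^sup>2)"
    and eq': "\<And>j. j < n \<Longrightarrow> (\<Sum>k<n. (if j = i \<or> k = i then 0 else G j k) * u' k) = lam' * u' j"
    and u'1: "(\<Sum>j<n. (u' j)\<^sup>2) = 1" and pos: "0 < lam'"
  shows "u' i = 0" "u i * (\<Sum>k<n. G i k * u' k) = (lam - lam') * (\<Sum>j<n. u j * u' j)"
    "(\<Sum>k<n. G i k * u' k) \<noteq> 0 \<Longrightarrow> lam' < lam"
proof -
  show zero: "u' i = 0" using eq'[OF i] pos by simp
  define c where "c = (\<Sum>k<n. G i k * u' k)"
  have Gu': "(\<Sum>k<n. G j k * u' k) = lam' * u' j + (if j = i then c else 0)" if "j < n" for j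
  proof (cases "j = i")
    case False
    then have "(\<Sum>k<n. G j k * u' k) = (\<Sum>k<n. (if j = i \<or> k = i then 0 else G j k) * u' k)"
      using zero by (intro sum.cong) auto
    then show ?thesis using eq'[OF that] False by simp
  qed (simp add: c_def zero)
  have del: "(\<Sum>j<n. f j * (if j = i then c else 0)) = f i * c" for f :: "nat \<Rightarrow> real"
    using i by (simp add: if_distrib[of "\<lambda>x. _ * x"] cong: if_cong)
  have "lam * (\<Sum>j<n. u j * u' j) = (\<Sum>j<n. (\<Sum>k<n. G j k * u k) * u' j)"
    by (simp add: sum_distrib_left eq mult.assoc)
  also have "\<dots> = (\<Sum>k<n. u k * (\<Sum>j<n. G k j * u' j))"
    unfolding sum_distrib_left sum_distrib_right
    by (subst sum.swap) (intro sum.cong, auto simp: sym mult_ac)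
  also have "\<dots> = (\<Sum>k<n. u k * (lam' * u' k) + u k * (if k = i then c else 0))"
    by (intro sum.cong refl) (simp only: Gu' lessThan_iff ring_distribs)
  also have "\<dots> = lam' * (\<Sum>j<n. u j * u' j) + u i * c"
    by (simp add: sum.distrib del sum_distrib_left mult_ac)
  finally show "u i * (\<Sum>k<n. G i k * u' k) = (lam - lam') * (\<Sum>j<n. u j * u' j)"
    by (simp add: c_def algebra_simps)
  have "quad_form n G u' = (\<Sum>j<n. u' j * (\<Sum>k<n. G j k * u' k))"
    unfolding quad_form_def by (simp add: sum_distrib_left mult_ac)
  also have "\<dots> = (\<Sum>j<n. lam' * (u' j)\<^sup>2 + u' j * (if j = i then c else 0))"
    by (intro sum.cong refl) (simp only: Gu' lessThan_iff ring_distribs power2_eq_square mult.left_commute)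
  also have "\<dots> = lam'" by (simp add: sum.distrib del zero sum_distrib_left[symmetric] u'1)
  finally have q: "quad_form n G u' = lam'" .
  then have "lam' \<le> lam" using ray[of u'] u'1 by simp
  \<comment> \<open>With equal eigenvalues \<open>u'\<close> maximizes the form of \<open>G\<close>,
    so it is an eigenvector of \<open>G\<close>; its \<open>i\<close>-th equation then reads
    \<open>c = lam * u' i = 0\<close>.\<close>
  moreover have "c = 0" if "lam = lam'"
    using quad_form_maximizer_eigen[OF sym ray _ i, of u'] q u'1 zero that by (simp add: c_def)
  ultimately show "(\<Sum>k<n. G i k * u' k) \<noteq> 0 \<Longrightarrow> lam' < lam"
    by (fastforce simp: c_def)
qed

section \<open>Rounding to integer vectors for functions affine in each coordinate\<close>

lemma affine_le_endpoint:
  fixes a b :: real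
  assumes "a \<le> x" "x \<le> b"
  obtains t where "t \<in> {a, b}" "\<alpha> + \<beta> * x \<le> \<alpha> + \<beta> * t"
proof (cases "0 \<le> \<beta>")
  case True
  then show ?thesis using that[of b] assms by (simp add: mult_left_mono)
next
  case False
  then show ?thesis using that[of a] assms by (simp add: mult_left_mono_neg)
qed

text \<open>Coordinates are rounded one after another. With the others fixed, \<open>f\<close> is
  affine in the current one, so one of the two neighbouring integers does not decrease it; which of
  the two may depend on the earlier choices.\<close>

lemma multiaffine_le_lattice_vertex:
  fixes f :: "(nat \<Rightarrow> real) \<Rightarrow> real"
  assumes aff: "\<And>i v. i < n \<Longrightarrow> \<exists>\<alpha> \<beta>. \<forall>t. f (v(i := t)) = \<alpha> + \<beta> * t"
  shows "\<exists>k::nat \<Rightarrow> int. f v \<le> f (\<lambda>i. if i < n then real_of_int (k i) else v i) \<and> (\<forall>i<n. k i \<in> {\<lfloor>v i\<rfloor>, \<lceil>v i\<rceil>})"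
proof -
  have "m \<le> n \<Longrightarrow> \<exists>k::nat \<Rightarrow> int. f v \<le> f (\<lambda>i. if i < m then real_of_int (k i) else v i) \<and> (\<forall>i<m. k i \<in> {\<lfloor>v i\<rfloor>, \<lceil>v i\<rceil>})" for m
  proof (induction m)
    case 0
    then show ?case by auto
  next
    case (Suc m)
    then obtain k :: "nat \<Rightarrow> int" where k: "f v \<le> f (\<lambda>i. if i < m then real_of_int (k i) else v i)"
        "\<forall>i<m. k i \<in> {\<lfloor>v i\<rfloor>, \<lceil>v i\<rceil>}" by auto
    define w where "w i = (if i < m then real_of_int (k i) else v i)" for i
    obtain \<alpha> \<beta> where ab: "\<And>t. f (w(m := t)) = \<alpha> + \<beta> * t" using aff[of m w] Suc.prems by auto
    obtain t where t: "t \<in> {real_of_int \<lfloor>v m\<rfloor>, real_of_int \<lceil>v m\<rceil>}" "\<alpha> + \<beta> * v m \<le> \<alpha> + \<beta> * t"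
      by (rule affine_le_endpoint[of "real_of_int \<lfloor>v m\<rfloor>" "v m" "real_of_int \<lceil>v m\<rceil>"]) auto
    then obtain j :: int where j: "j \<in> {\<lfloor>v m\<rfloor>, \<lceil>v m\<rceil>}" "t = real_of_int j" by auto
    have "w(m := v m) = w" by (auto simp: w_def)
    then have "f v \<le> f (w(m := t))" using k(1) ab[of "v m"] ab[of t] t(2) by (simp add: w_def[abs_def])
    moreover have "w(m := t) = (\<lambda>i. if i < Suc m then real_of_int ((k(m := j)) i) else v i)"
      by (auto simp: w_def j)
    ultimately show ?case using k(2) j(1) by (intro exI[of _ "k(m := j)"]) (auto simp: less_Suc_eq)
  qed
  then show ?thesis by blast
qed

lemma quad_form_hollow_affine:
  assumes sym: "\<And>j k. j < n \<Longrightarrow> k < n \<Longrightarrow> G j k = G k j" and i: "i < n" and diag: "G i i = 0"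
  shows "\<exists>\<alpha> \<beta>. \<forall>t. quad_form n G (v(i := t)) = \<alpha> + \<beta> * t"
proof (intro exI allI)
  fix t
  show "quad_form n G (v(i := t)) = (quad_form n G v - 2 * v i * (\<Sum>j<n. G i j * v j)) + (2 * (\<Sum>j<n. G i j * v j)) * t"
    using quad_form_add_coord[where G=G, OF sym i, of v "t - v i"] diag by (simp add: algebra_simps)
qed

section \<open>Alignment with the label vector\<close>

lemma quad_form_hollow_gram:
  fixes a :: "nat \<Rightarrow> nat \<Rightarrow> real"
  shows "quad_form n (\<lambda>i j. if i = j then 0 else \<Sum>l<d. a i l * a j l) v
    = (\<Sum>l<d. (\<Sum>i<n. v i * a i l)\<^sup>2) - (\<Sum>i<n. (v i)\<^sup>2 * (\<Sum>l<d. (a i l)\<^sup>2))"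
proof -
  have "(\<Sum>i<n. \<Sum>j<n. (\<Sum>l<d. a i l * a j l) * v i * v j) = (\<Sum>i<n. \<Sum>l<d. \<Sum>j<n. (v i * a i l) * (v j * a j l))"
    by (subst (2) sum.swap) (simp add: sum_distrib_left sum_distrib_right mult_ac)
  also have "\<dots> = (\<Sum>l<d. \<Sum>i<n. \<Sum>j<n. (v i * a i l) * (v j * a j l))"
    by (rule sum.swap)
  also have "\<dots> = (\<Sum>l<d. (\<Sum>i<n. v i * a i l)\<^sup>2)"
    by (simp add: power2_eq_square sum_product)
  finally have full: "(\<Sum>i<n. \<Sum>j<n. (\<Sum>l<d. a i l * a j l) * v i * v j) = (\<Sum>l<d. (\<Sum>i<n. v i * a i l)\<^sup>2)" .
  have "quad_form n (\<lambda>i j. if i = j then 0 else \<Sum>l<d. a i l * a j l) v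
     = (\<Sum>i<n. \<Sum>j<n. (\<Sum>l<d. a i l * a j l) * v i * v j - (if j = i then (v i)\<^sup>2 * (\<Sum>l<d. (a i l)\<^sup>2) else 0))"
    unfolding quad_form_def by (intro sum.cong refl) (auto simp: power2_eq_square)
  also have "\<dots> = (\<Sum>i<n. \<Sum>j<n. (\<Sum>l<d. a i l * a j l) * v i * v j) - (\<Sum>i<n. (v i)\<^sup>2 * (\<Sum>l<d. (a i l)\<^sup>2))"
    unfolding sum_subtractf by simp
  finally show ?thesis using full by simp
qed

lemma abs_sum_mult_le:
  fixes v w :: "nat \<Rightarrow> real"
  assumes "(\<Sum>i<n. (v i)\<^sup>2) \<le> S" "(\<Sum>i<n. (w i)\<^sup>2) \<le> R"
  shows "\<bar>\<Sum>i<n. v i * w i\<bar> \<le> sqrt S * sqrt R"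
proof -
  have "(\<Sum>i<n. v i * w i)\<^sup>2 \<le> (\<Sum>i<n. (v i)\<^sup>2) * (\<Sum>i<n. (w i)\<^sup>2)"
    by (rule Cauchy_Schwarz_ineq_sum)
  also have "\<dots> \<le> S * R"
  proof (rule mult_mono[OF assms])
    show "0 \<le> S" by (rule order_trans[OF sum_nonneg assms(1)]) auto
  qed (simp add: sum_nonneg)
  finally show ?thesis
    using real_sqrt_le_mono[of "(\<Sum>i<n. v i * w i)\<^sup>2" "S * R"] by (simp add: real_sqrt_mult)
qed

text \<open>Split both vectors along \<open>y\<close> and orthogonally to it. The parallel parts
  contribute \<open>A * B / n\<close>, of absolute value above 1/2; each orthogonal part has squared
  norm below 1/2, so by Cauchy-Schwarz they contribute at most 1/2.\<close>

lemma inner_product_sign_of_aligned: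
  fixes u v y :: "nat \<Rightarrow> real"
  assumes n: "0 < n" and y: "\<And>i. i < n \<Longrightarrow> (y i)\<^sup>2 = 1"
    and u: "(\<Sum>i<n. (u i)\<^sup>2) = 1" and v: "(\<Sum>i<n. (v i)\<^sup>2) = 1"
    and a: "real n / 2 < (\<Sum>i<n. y i * u i)\<^sup>2" and b: "real n / 2 < (\<Sum>i<n. y i * v i)\<^sup>2"
  shows "sgn (\<Sum>i<n. u i * v i) = sgn (\<Sum>i<n. y i * u i) * sgn (\<Sum>i<n. y i * v i)"
proof -
  define A where "A = (\<Sum>i<n. y i * u i)"
  define B where "B = (\<Sum>i<n. y i * v i)"
  have yy: "(\<Sum>i<n. y i * y i) = real n" using y by (simp add: power2_eq_square)
  have expand: "(\<Sum>i<n. (f i - s / n * y i) * (g i - t / n * y i))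
      = (\<Sum>i<n. f i * g i) - t / n * (\<Sum>i<n. y i * f i) - s / n * (\<Sum>i<n. y i * g i) + s * t / n" for f g s t
  proof -
    have "(\<Sum>i<n. (f i - s / n * y i) * (g i - t / n * y i))
      = (\<Sum>i<n. f i * g i - t / n * (y i * f i) - s / n * (y i * g i) + s / n * (t / n) * (y i * y i))"
      by (intro sum.cong refl) (simp only: algebra_simps)
    also have "\<dots> = (\<Sum>i<n. f i * g i) - t / n * (\<Sum>i<n. y i * f i) - s / n * (\<Sum>i<n. y i * g i) + s / n * (t / n) * real n"
      by (simp only: sum.distrib sum_subtractf sum_distrib_left[symmetric] yy)
    finally show ?thesis using n by simp
  qed
  have r: "(\<Sum>i<n. (u i - A / n * y i)\<^sup>2) = 1 - A\<^sup>2 / n"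
    using expand[of u A u A] u by (simp add: power2_eq_square A_def[symmetric])
  have r': "(\<Sum>i<n. (v i - B / n * y i)\<^sup>2) = 1 - B\<^sup>2 / n"
    using expand[of v B v B] v by (simp add: power2_eq_square B_def[symmetric])
  have rr: "(\<Sum>i<n. (u i - A / n * y i) * (v i - B / n * y i)) = (\<Sum>i<n. u i * v i) - A * B / n"
    using expand[of u A v B] by (simp add: A_def[symmetric] B_def[symmetric])
  have A2: "1 / 2 < A\<^sup>2 / n" and B2: "1 / 2 < B\<^sup>2 / n"
    using a b n by (auto simp: A_def B_def field_simps)
  have "\<bar>(\<Sum>i<n. u i * v i) - A * B / n\<bar> \<le> sqrt (1 / 2) * sqrt (1 / 2)"
    unfolding rr[symmetric] by (rule abs_sum_mult_le) (use r r' A2 B2 in auto)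
  then have close: "\<bar>(\<Sum>i<n. u i * v i) - A * B / n\<bar> \<le> 1 / 2" by simp
  have "(1 / 2)\<^sup>2 < (A\<^sup>2 / n) * (B\<^sup>2 / n)"
    unfolding power2_eq_square[of "1 / 2"] using A2 B2 by (intro mult_strict_mono) linarith+
  also have "\<dots> = \<bar>A * B / n\<bar>\<^sup>2" by (simp add: power2_eq_square)
  finally have far: "1 / 2 < \<bar>A * B / n\<bar>" by (rule power2_less_imp_less) simp
  have "sgn (\<Sum>i<n. u i * v i) = sgn (A * B / n)"
  proof (cases "0 < A * B / n")
    case True
    then have "0 < (\<Sum>i<n. u i * v i)" using close far by linarith
    then show ?thesis using True by (simp only: sgn_pos)
  next
    case False
    then have "(\<Sum>i<n. u i * v i) < 0" "A * B / n < 0" using close far by linarith+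
    then show ?thesis by (simp only: sgn_neg)
  qed
  also have "\<dots> = sgn A * sgn B" using n by (simp add: sgn_mult sgn_divide)
  finally show ?thesis by (simp add: A_def B_def)
qed

definition gram_entry :: "nat \<Rightarrow> (nat \<Rightarrow> real) \<Rightarrow> (nat \<Rightarrow> real) \<Rightarrow> ((nat \<times> nat) \<Rightarrow> real) \<Rightarrow> nat \<Rightarrow> nat \<Rightarrow> real" where
  "gram_entry d y mu z i j = (if i = j then 0 else \<Sum>k<d. data_x y mu z i k * data_x y mu z j k)"

lemma hollow_gram_eq: "hollow_gram n d y mu z = mat n n (\<lambda>(i, j). gram_entry d y mu z i j)"
  by (simp add: hollow_gram_def gram_entry_def cong: if_cong)

lemma gram_entry_sym: "gram_entry d y mu z i j = gram_entry d y mu z j i"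
  by (simp add: gram_entry_def mult.commute)

text \<open>A single fixed noise array: everything inside is deterministic, and randomness enters
  only through \<open>regular_noise\<close>. The number \<open>m\<close> is the length of the mean
  vector.\<close>

locale regular_instance =
  fixes n d :: nat and y mu :: "nat \<Rightarrow> real" and z :: "nat \<times> nat \<Rightarrow> real" and m :: real
  assumes n: "2 \<le> n" and y: "\<And>i. i < n \<Longrightarrow> y i \<in> {-1, 1}"
    and reg: "regular_noise n d mu z" and m: "m = sqrt (\<Sum>l<d. (mu l)\<^sup>2)" and m_pos: "0 < m"
begin

abbreviation "B \<equiv> noise_bound n d"

definition proj :: "nat \<Rightarrow> real" where "proj i = (\<Sum>l<d. z (i, l) * mu l)"

definition align :: "(nat \<Rightarrow> real) \<Rightarrow> real" where "align v = (\<Sum>i<n. y i * v i)"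

abbreviation "noise_entry i j \<equiv> (if i = j then 0 else \<Sum>l<d. z (i, l) * z (j, l))"

lemma B_nonneg: "0 \<le> B"
  by (simp add: noise_bound_def)

lemma m2: "(\<Sum>l<d. (mu l)\<^sup>2) = m\<^sup>2"
  unfolding m by (simp add: sum_nonneg)

lemma y2: "i < n \<Longrightarrow> (y i)\<^sup>2 = 1" "i < n \<Longrightarrow> \<bar>y i\<bar> = 1"
  using y[of i] by auto

lemma proj_bound: "(\<Sum>i<n. (proj i)\<^sup>2) \<le> (6 * sqrt n * m)\<^sup>2"
  using reg by (simp add: regular_noise_def proj_def m2 power_mult_distrib)

lemma noise_row: "i < n \<Longrightarrow> \<bar>(\<Sum>l<d. (z (i, l))\<^sup>2) - real d\<bar> \<le> B"
proof -
  assume i: "i < n"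
  define k where "k j = (if j = i then 1 else 0 :: int)" for j
  have k2: "(\<Sum>j<n. (real_of_int (k j))\<^sup>2) = 1"
    using i by (simp add: k_def if_distrib[of real_of_int] if_distrib[of "\<lambda>x. x\<^sup>2"] cong: if_cong)
  have kz: "(\<Sum>j<n. real_of_int (k j) * z (j, l)) = z (i, l)" for l
    using i by (simp add: k_def if_distrib[of real_of_int] if_distrib[of "\<lambda>x. x * _"] cong: if_cong)
  show ?thesis
    using reg n unfolding regular_noise_def by (elim conjE allE[of _ k]) (simp add: k2 kz)
qed

text \<open>One \<open>B\<close> bounds the deviation of the full form from \<open>d\<close> times
  the squared norm, the other that of the deleted diagonal, row by row; the two multiples of
  \<open>d\<close> cancel.\<close>

lemma noise_quad_lattice:
  fixes k :: "nat \<Rightarrow> int"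
  assumes k: "(\<Sum>i<n. (real_of_int (k i))\<^sup>2) \<le> 4 * real n"
  shows "\<bar>quad_form n noise_entry (\<lambda>i. real_of_int (k i))\<bar> \<le> 2 * B * (\<Sum>i<n. (real_of_int (k i))\<^sup>2)"
proof -
  let ?S = "\<Sum>i<n. (real_of_int (k i))\<^sup>2"
  have 1: "\<bar>(\<Sum>l<d. (\<Sum>i<n. real_of_int (k i) * z (i, l))\<^sup>2) - real d * ?S\<bar> \<le> B * ?S"
    using reg k unfolding regular_noise_def by blast
  have "\<bar>(\<Sum>i<n. (real_of_int (k i))\<^sup>2 * (\<Sum>l<d. (z (i, l))\<^sup>2)) - real d * ?S\<bar>
     = \<bar>\<Sum>i<n. (real_of_int (k i))\<^sup>2 * ((\<Sum>l<d. (z (i, l))\<^sup>2) - real d)\<bar>"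
    by (simp add: sum_distrib_left sum_subtractf[symmetric] algebra_simps)
  also have "\<dots> \<le> (\<Sum>i<n. \<bar>(real_of_int (k i))\<^sup>2 * ((\<Sum>l<d. (z (i, l))\<^sup>2) - real d)\<bar>)" by (rule sum_abs)
  also have "\<dots> \<le> (\<Sum>i<n. (real_of_int (k i))\<^sup>2 * B)"
    by (intro sum_mono) (simp add: abs_mult noise_row mult_left_mono)
  also have "\<dots> = B * ?S" by (simp add: sum_distrib_left mult.commute)
  finally have "\<bar>(\<Sum>i<n. (real_of_int (k i))\<^sup>2 * (\<Sum>l<d. (z (i, l))\<^sup>2)) - real d * ?S\<bar> \<le> B * ?S" .
  with 1 show ?thesis unfolding quad_form_hollow_gram by linarith
qed

text \<open>The unit vector is scaled to squared length \<open>n\<close> and rounded upward in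
  value. Rounding moves an entry by at most 1, so the squared norm of the integer vector is at most
  \<open>2 * n + 2 * n\<close>; dividing \<open>2 * B * (4 * n)\<close> by \<open>n\<close> gives
  \<open>8 * B\<close>. Rounding yields an upper bound only; the lower bounds that follow concern
  test vectors that are already integral.\<close>

lemma noise_quad_le:
  assumes v: "(\<Sum>i<n. (v i)\<^sup>2) = 1"
  shows "quad_form n noise_entry v \<le> 8 * B"
proof -
  define w where "w i = sqrt n * v i" for i
  have w2: "(\<Sum>i<n. (w i)\<^sup>2) = real n"
    by (simp add: w_def power_mult_distrib sum_distrib_left[symmetric] v)
  have "\<exists>k::nat \<Rightarrow> int. quad_form n noise_entry w \<le> quad_form n noise_entry (\<lambda>i. if i < n then real_of_int (k i) else w i) \<and> (\<forall>i<n. k i \<in> {\<lfloor>w i\<rfloor>, \<lceil>w i\<rceil>})"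
    by (intro multiaffine_le_lattice_vertex quad_form_hollow_affine) (auto simp: mult.commute)
  then obtain k :: "nat \<Rightarrow> int" where k: "quad_form n noise_entry w \<le> quad_form n noise_entry (\<lambda>i. if i < n then real_of_int (k i) else w i)"
    and ki: "\<And>i. i < n \<Longrightarrow> k i \<in> {\<lfloor>w i\<rfloor>, \<lceil>w i\<rceil>}" by blast
  have "(real_of_int (k i))\<^sup>2 \<le> 2 * (w i)\<^sup>2 + 2" if "i < n" for i
  proof -
    have "\<bar>real_of_int (k i)\<bar> \<le> \<bar>\<bar>w i\<bar> + 1\<bar>" using ki[OF that] by (auto; linarith)
    then have "(real_of_int (k i))\<^sup>2 \<le> (\<bar>w i\<bar> + 1)\<^sup>2" by (simp only: abs_le_square_iff)
    also have "\<dots> \<le> 2 * (w i)\<^sup>2 + 2"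
      using zero_le_power2[of "\<bar>w i\<bar> - 1"] by (simp add: power2_eq_square algebra_simps)
    finally show ?thesis .
  qed
  then have "(\<Sum>i<n. (real_of_int (k i))\<^sup>2) \<le> (\<Sum>i<n. 2 * (w i)\<^sup>2 + 2)" by (intro sum_mono) auto
  also have "\<dots> = 4 * real n" by (simp add: sum.distrib sum_distrib_left[symmetric] w2)
  finally have k4: "(\<Sum>i<n. (real_of_int (k i))\<^sup>2) \<le> 4 * real n" .
  have "real n * quad_form n noise_entry v = quad_form n noise_entry w"
    by (simp add: w_def[abs_def] quad_form_scale)
  also note k
  also have "quad_form n noise_entry (\<lambda>i. if i < n then real_of_int (k i) else w i) = quad_form n noise_entry (\<lambda>i. real_of_int (k i))"
    unfolding quad_form_def by (intro sum.cong) auto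
  also have "\<dots> \<le> 2 * B * (\<Sum>i<n. (real_of_int (k i))\<^sup>2)" using noise_quad_lattice[OF k4] by linarith
  also have "\<dots> \<le> 2 * B * (4 * real n)" using B_nonneg by (intro mult_left_mono k4) auto
  finally show ?thesis using n by (simp add: mult.commute mult.left_commute)
qed

text \<open>Restores the diagonal, at most \<open>d + B\<close>, to the hollow form.\<close>

lemma noise_norm_le:
  assumes v: "(\<Sum>i<n. (v i)\<^sup>2) = 1"
  shows "(\<Sum>l<d. (\<Sum>i<n. v i * z (i, l))\<^sup>2) \<le> real d + 9 * B"
proof -
  have "(\<Sum>i<n. (v i)\<^sup>2 * (\<Sum>l<d. (z (i, l))\<^sup>2)) \<le> (\<Sum>i<n. (v i)\<^sup>2 * (real d + B))"
  proof (intro sum_mono mult_left_mono)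
    fix i assume "i \<in> {..<n}"
    then show "(\<Sum>l<d. (z (i, l))\<^sup>2) \<le> real d + B" using noise_row[of i] by (simp add: abs_le_iff)
  qed simp
  also have "\<dots> = real d + B" by (simp add: sum_distrib_right[symmetric] v)
  finally show ?thesis using noise_quad_le[OF v] unfolding quad_form_hollow_gram by linarith
qed

lemma data_combination:
  "(\<Sum>i<n. v i * data_x y mu z i l) = align v * mu l + (\<Sum>i<n. v i * z (i, l))"
  by (simp add: data_x_def align_def sum_distrib_left sum_distrib_right sum.distrib algebra_simps)

lemma proj_combination: "(\<Sum>l<d. mu l * (\<Sum>i<n. v i * z (i, l))) = (\<Sum>i<n. v i * proj i)"
  unfolding proj_def sum_distrib_left by (subst sum.swap) (simp add: mult_ac)

lemma data_combination_norm:
  "(\<Sum>l<d. (\<Sum>i<n. v i * data_x y mu z i l)\<^sup>2)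
    = (align v)\<^sup>2 * m\<^sup>2 + 2 * align v * (\<Sum>i<n. v i * proj i) + (\<Sum>l<d. (\<Sum>i<n. v i * z (i, l))\<^sup>2)"
proof -
  have "(\<Sum>l<d. (\<Sum>i<n. v i * data_x y mu z i l)\<^sup>2)
     = (\<Sum>l<d. (align v)\<^sup>2 * (mu l)\<^sup>2 + 2 * align v * (mu l * (\<Sum>i<n. v i * z (i, l))) + (\<Sum>i<n. v i * z (i, l))\<^sup>2)"
    unfolding data_combination by (intro sum.cong refl) (simp only: power2_eq_square algebra_simps mult_2)
  also have "\<dots> = (align v)\<^sup>2 * (\<Sum>l<d. (mu l)\<^sup>2) + 2 * align v * (\<Sum>l<d. mu l * (\<Sum>i<n. v i * z (i, l)))
     + (\<Sum>l<d. (\<Sum>i<n. v i * z (i, l))\<^sup>2)"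
    by (simp only: sum.distrib sum_distrib_left[symmetric])
  finally show ?thesis by (simp only: m2 proj_combination)
qed

lemma data_norm:
  assumes "i < n"
  shows "(\<Sum>l<d. (data_x y mu z i l)\<^sup>2) = m\<^sup>2 + 2 * y i * proj i + (\<Sum>l<d. (z (i, l))\<^sup>2)"
proof -
  have "(\<Sum>l<d. (data_x y mu z i l)\<^sup>2) = (\<Sum>l<d. (y i)\<^sup>2 * (mu l)\<^sup>2 + 2 * y i * (z (i, l) * mu l) + (z (i, l))\<^sup>2)"
    unfolding data_x_def by (intro sum.cong refl) (simp only: power2_eq_square algebra_simps mult_2)
  also have "\<dots> = (y i)\<^sup>2 * (\<Sum>l<d. (mu l)\<^sup>2) + 2 * y i * proj i + (\<Sum>l<d. (z (i, l))\<^sup>2)"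
    by (simp only: sum.distrib sum_distrib_left[symmetric] proj_def)
  finally show ?thesis by (simp only: m2 y2[OF assms] mult_1)
qed

text \<open>Signal, cross terms and noise. The subtracted squared norm and the second cross sum come
  from deleting the diagonal, where the squared labels are 1.\<close>

lemma gram_quad:
  "quad_form n (gram_entry d y mu z) v = m\<^sup>2 * ((align v)\<^sup>2 - (\<Sum>i<n. (v i)\<^sup>2)) + 2 * align v * (\<Sum>i<n. v i * proj i)
    - 2 * (\<Sum>i<n. (v i)\<^sup>2 * (y i * proj i)) + quad_form n noise_entry v"
proof -
  have "(\<Sum>i<n. (v i)\<^sup>2 * (\<Sum>l<d. (data_x y mu z i l)\<^sup>2))
     = (\<Sum>i<n. m\<^sup>2 * (v i)\<^sup>2 + 2 * ((v i)\<^sup>2 * (y i * proj i)) + (v i)\<^sup>2 * (\<Sum>l<d. (z (i, l))\<^sup>2))"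
    by (intro sum.cong refl) (simp only: data_norm lessThan_iff algebra_simps)
  also have "\<dots> = m\<^sup>2 * (\<Sum>i<n. (v i)\<^sup>2) + 2 * (\<Sum>i<n. (v i)\<^sup>2 * (y i * proj i)) + (\<Sum>i<n. (v i)\<^sup>2 * (\<Sum>l<d. (z (i, l))\<^sup>2))"
    by (simp only: sum.distrib sum_distrib_left[symmetric])
  finally show ?thesis
    unfolding gram_entry_def[abs_def] quad_form_hollow_gram data_combination_norm by (simp add: algebra_simps)
qed

lemma sqrt_n: "1 \<le> sqrt n" "sqrt n * sqrt n = n" "sqrt n \<le> n"
proof -
  show "1 \<le> sqrt n" using n by simp
  then have "sqrt n * 1 \<le> sqrt n * sqrt n" by (intro mult_left_mono) auto
  then show "sqrt n \<le> n" by simp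
qed simp

lemma proj_le: "i < n \<Longrightarrow> \<bar>proj i\<bar> \<le> 6 * real n * m"
proof -
  assume i: "i < n"
  have "(proj i)\<^sup>2 \<le> (\<Sum>i<n. (proj i)\<^sup>2)" using i by (intro member_le_sum) auto
  also note proj_bound
  finally have "\<bar>proj i\<bar> \<le> 6 * sqrt n * m"
    using m_pos abs_le_square_iff[of "proj i" "6 * sqrt n * m"] by simp
  also have "\<dots> \<le> 6 * real n * m" using m_pos sqrt_n by simp
  finally show ?thesis .
qed

lemma align_le:
  assumes "(\<Sum>i<n. (v i)\<^sup>2) \<le> S"
  shows "\<bar>align v\<bar> \<le> sqrt n * sqrt S"
  unfolding align_def by (rule abs_sum_mult_le) (auto simp: y2 assms)

lemma proj_combination_le:
  assumes "(\<Sum>i<n. (v i)\<^sup>2) \<le> S"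
  shows "\<bar>\<Sum>i<n. v i * proj i\<bar> \<le> sqrt S * (6 * sqrt n * m)"
  using abs_sum_mult_le[OF assms proj_bound] m_pos by (simp add: real_sqrt_mult)

lemma cross_le:
  assumes S: "(\<Sum>i<n. (v i)\<^sup>2) = S"
  shows "\<bar>2 * align v * (\<Sum>i<n. v i * proj i) - 2 * (\<Sum>i<n. (v i)\<^sup>2 * (y i * proj i))\<bar> \<le> 24 * real n * m * S"
proof -
  have S0: "0 \<le> S" unfolding S[symmetric] by (simp add: sum_nonneg)
  have "\<bar>align v * (\<Sum>i<n. v i * proj i)\<bar> \<le> (sqrt n * sqrt S) * (sqrt S * (6 * sqrt n * m))"
    unfolding abs_mult using align_le[of v S] proj_combination_le[of v S] S S0 by (intro mult_mono) auto
  also have "\<dots> = 6 * (sqrt n * sqrt n) * m * (sqrt S * sqrt S)" by (simp only: mult_ac)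
  also have "\<dots> = 6 * real n * m * S" using S0 by simp
  finally have 1: "\<bar>align v * (\<Sum>i<n. v i * proj i)\<bar> \<le> 6 * real n * m * S" .
  have "\<bar>\<Sum>i<n. (v i)\<^sup>2 * (y i * proj i)\<bar> \<le> (\<Sum>i<n. \<bar>(v i)\<^sup>2 * (y i * proj i)\<bar>)" by (rule sum_abs)
  also have "\<dots> \<le> (\<Sum>i<n. (v i)\<^sup>2 * (6 * real n * m))"
    unfolding abs_mult by (intro sum_mono) (use y2 proj_le in \<open>auto intro!: mult_left_mono\<close>)
  also have "\<dots> = 6 * real n * m * S" by (simp add: sum_distrib_right[symmetric] S)
  finally have 2: "\<bar>\<Sum>i<n. (v i)\<^sup>2 * (y i * proj i)\<bar> \<le> 6 * real n * m * S" .
  show ?thesis using 1 2 by (simp only: abs_le_iff mult.assoc) linarith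
qed

lemma gram_quad_upper:
  assumes v: "(\<Sum>i<n. (v i)\<^sup>2) = 1"
  shows "quad_form n (gram_entry d y mu z) v \<le> m\<^sup>2 * ((align v)\<^sup>2 - 1) + 24 * real n * m + 8 * B"
  using cross_le[OF v] noise_quad_le[OF v] unfolding gram_quad v by (simp only: abs_le_iff) linarith

text \<open>The labels restricted to \<open>T\<close> form an integer vector, to which the two-sided
  lattice estimate applies directly. \<open>T\<close> will be all indices for \<open>lam\<close> and
  all but \<open>i\<close> for \<open>lam'\<close>.\<close>

lemma gram_quad_lower:
  assumes T: "T \<subseteq> {..<n}"
  shows "real (card T) * (m\<^sup>2 * (real (card T) - 1) - 24 * real n * m - 8 * B)
     \<le> quad_form n (gram_entry d y mu z) (\<lambda>i. if i \<in> T then y i else 0)"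
    and "(\<Sum>i<n. (if i \<in> T then y i else 0)\<^sup>2) = real (card T)"
proof -
  define v where "v i = (if i \<in> T then y i else 0)" for i
  define p where "p = real (card T)"
  have sumT: "(\<Sum>i<n. if i \<in> T then 1 else 0 :: real) = p"
    using T by (simp add: p_def sum.If_cases Int_absorb1)
  have v2: "(v i)\<^sup>2 = (if i \<in> T then 1 else 0)" "y i * v i = (if i \<in> T then 1 else 0)" if "i < n" for i
    using y2[OF that] by (auto simp: v_def power2_eq_square)
  have S: "(\<Sum>i<n. (v i)\<^sup>2) = p" using sumT by (simp add: v2)
  then show "(\<Sum>i<n. (if i \<in> T then y i else 0)\<^sup>2) = real (card T)" by (simp add: v_def p_def)
  have al: "align v = p" using sumT by (simp add: align_def v2)
  define k where "k i = (if i \<in> T then if y i = 1 then 1 else - 1 else 0 :: int)" for i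
  have k: "real_of_int (k i) = v i" if "i < n" for i
    using y[OF that] by (auto simp: k_def v_def)
  have pn: "p \<le> real n" unfolding p_def using card_mono[OF _ T] by simp
  have kS: "(\<Sum>i<n. (real_of_int (k i))\<^sup>2) = p" using S by (simp add: k)
  have "\<bar>quad_form n noise_entry (\<lambda>i. real_of_int (k i))\<bar> \<le> 2 * B * p"
    using noise_quad_lattice[of k] kS pn n by simp
  also have "quad_form n noise_entry (\<lambda>i. real_of_int (k i)) = quad_form n noise_entry v"
    unfolding quad_form_def by (intro sum.cong) (auto simp: k)
  finally have "- (2 * B * p) \<le> quad_form n noise_entry v" by linarith
  moreover have "2 * B * p \<le> 8 * B * p" using B_nonneg by (simp add: p_def mult_right_mono)
  moreover note cross_le[OF S]
  ultimately have "m\<^sup>2 * (p\<^sup>2 - p) - 24 * real n * m * p - 8 * B * p \<le> quad_form n (gram_entry d y mu z) v"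
    unfolding gram_quad S al by linarith
  then show "real (card T) * (m\<^sup>2 * (real (card T) - 1) - 24 * real n * m - 8 * B)
     \<le> quad_form n (gram_entry d y mu z) (\<lambda>i. if i \<in> T then y i else 0)"
    unfolding p_def[symmetric] v_def[abs_def, symmetric] by (simp add: algebra_simps power2_eq_square)
qed

lemma rayleigh_lower:
  assumes T: "T \<subseteq> {..<n}" "T \<noteq> {}"
    and ray: "quad_form n (gram_entry d y mu z) (\<lambda>i. if i \<in> T then y i else 0)
        \<le> lam * (\<Sum>i<n. (if i \<in> T then y i else 0)\<^sup>2)"
  shows "m\<^sup>2 * (real (card T) - 1) - 24 * real n * m - 8 * B \<le> lam"
proof -
  have "0 < card T" using T by (auto simp: card_gt_0_iff finite_subset)
  then have p: "0 < real (card T)" by simp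
  have "real (card T) * (m\<^sup>2 * (real (card T) - 1) - 24 * real n * m - 8 * B) \<le> real (card T) * lam"
    using gram_quad_lower(1)[OF T(1)] ray unfolding gram_quad_lower(2)[OF T(1)] by (simp add: mult.commute)
  then show ?thesis using p by simp
qed

text \<open>The eigenvalue is at least the value at the label vector and at most the upper bound at
  \<open>v\<close>; comparing the two doubles each error term.\<close>

lemma alignment:
  assumes "m\<^sup>2 * (p - 1) - 24 * real n * m - 8 * B \<le> lam" "(\<Sum>i<n. (v i)\<^sup>2) = 1"
    and "quad_form n (gram_entry d y mu z) v = lam"
  shows "m\<^sup>2 * p - 48 * real n * m - 16 * B \<le> m\<^sup>2 * (align v)\<^sup>2"
  using gram_quad_upper[OF assms(2)] assms(1,3) by (simp add: algebra_simps)

end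

section \<open>Leave-one-out\<close>

text \<open>Replaces the \<open>i\<close>-th noise row so that the \<open>i\<close>-th data point becomes \<open>0\<close>.\<close>
definition reset_row :: "nat \<Rightarrow> (nat \<Rightarrow> real) \<Rightarrow> (nat \<Rightarrow> real) \<Rightarrow> nat \<Rightarrow> ((nat \<times> nat) \<Rightarrow> real) \<Rightarrow> (nat \<times> nat) \<Rightarrow> real" where
  "reset_row d y mu i z = (\<lambda>(j, l). if j = i \<and> l < d then - (y i * mu l) else z (j, l))"

lemma data_x_reset_row:
  "l < d \<Longrightarrow> data_x y mu (reset_row d y mu i z) j l = (if j = i then 0 else data_x y mu z j l)"
  by (simp add: data_x_def reset_row_def)

lemma gram_entry_reset_row:
  "gram_entry d y mu (reset_row d y mu i z) j k = (if j = i \<or> k = i then 0 else gram_entry d y mu z j k)"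
  by (auto simp: gram_entry_def data_x_reset_row intro!: sum.neutral)

context regular_instance
begin

text \<open>The deterministic core. \<open>small\<close> makes both eigenvectors aligned and
  \<open>lam'\<close> positive; \<open>\<eta>\<close> is the relative loss in the squared alignment
  of \<open>u'\<close>; the condition on \<open>\<kappa>\<close> compares an upper bound for the
  squared length of \<open>q\<close> with a lower bound for its squared inner product with
  \<open>mu\<close>. A zero entry of \<open>u\<close> also counts as wrong.\<close>

lemma misclassified_large_deviation:
  fixes u u' :: "real vec"
  assumes i: "i < n"
    and lead: "leading_unit_eigvec (hollow_gram n d y mu z) u"
    and lead': "leading_unit_eigvec (hollow_gram n d y mu (reset_row d y mu i z)) u'"
    and small: "2 * m\<^sup>2 + 96 * real n * m + 32 * B < m\<^sup>2 * real n"
    and eta: "\<eta> = (m\<^sup>2 + 48 * real n * m + 16 * B) / (real n * m\<^sup>2)"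
    and pos: "0 < m\<^sup>2 * (1 - \<eta>) - 6 * m"
    and \<kappa>: "0 \<le> \<kappa>" "\<kappa>\<^sup>2 * (real n * m\<^sup>2 + 12 * real n * m + d + 9 * B) \<le> n * (m\<^sup>2 * (1 - \<eta>) - 6 * m)\<^sup>2"
    and q: "q = (\<lambda>l. \<Sum>j<n. vec_index u' j * data_x y mu (reset_row d y mu i z) j l)"
    and wrong: "sgn (vec_index u i) \<noteq> (if 0 \<le> align (vec_index u) then 1 else - 1) * y i"
  shows "0 < (\<Sum>l<d. (q l)\<^sup>2) \<and> \<kappa> * sqrt (\<Sum>l<d. (q l)\<^sup>2) \<le> \<bar>\<Sum>l<d. z (i, l) * q l\<bar>"
proof -
  let ?G = "gram_entry d y mu z"
  let ?G' = "\<lambda>j k. if j = i \<or> k = i then 0 else ?G j k"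
  let ?u = "vec_index u" and ?u' = "vec_index u'"
  have m2pos: "0 < m\<^sup>2" using m_pos by simp
  obtain lam where u1: "(\<Sum>j<n. (?u j)\<^sup>2) = 1"
    and eq: "\<And>j. j < n \<Longrightarrow> (\<Sum>k<n. ?G j k * ?u k) = lam * ?u j"
    and ray: "\<And>w. quad_form n ?G w \<le> lam * (\<Sum>j<n. (w j)\<^sup>2)"
    and qu: "quad_form n ?G ?u = lam"
    by (rule leading_unit_eigvec_rayleigh[where G = ?G, OF lead[unfolded hollow_gram_eq] gram_entry_sym]) (rule that)
  have l': "leading_unit_eigvec (mat n n (\<lambda>(j, k). ?G' j k)) u'"
    using lead' unfolding hollow_gram_eq gram_entry_reset_row .
  have s': "?G' j k = ?G' k j" for j k
    using gram_entry_sym[of d y mu z j k] by auto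
  obtain lam' where u'1: "(\<Sum>j<n. (?u' j)\<^sup>2) = 1"
    and eq': "\<And>j. j < n \<Longrightarrow> (\<Sum>k<n. ?G' j k * ?u' k) = lam' * ?u' j"
    and ray': "\<And>w. quad_form n ?G' w \<le> lam' * (\<Sum>j<n. (w j)\<^sup>2)"
    and qu': "quad_form n ?G' ?u' = lam'"
    by (rule leading_unit_eigvec_rayleigh[where G = ?G', OF l' s']) (rule that)
  \<comment> \<open>This transfers statements about the reduced matrix to the original one, so the
    estimates for the given noise array apply to \<open>u'\<close> as well.\<close>
  have G'w: "quad_form n ?G w = quad_form n ?G' w" if "w i = 0" for w
    unfolding quad_form_def using that by (intro sum.cong refl) auto
  have "real n * m \<ge> 0" using m_pos by simp
  define T where "T = {..<n} - {i}"
  have cT: "real (card T) = real n - 1" using i by (simp add: T_def of_nat_diff)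
  have low': "m\<^sup>2 * (real (card T) - 1) - 24 * real n * m - 8 * B \<le> lam'"
  proof (rule rayleigh_lower)
    have "(if i = 0 then 1 else 0) \<in> T" using n by (auto simp: T_def)
    then show "T \<noteq> {}" by blast
    show "quad_form n ?G (\<lambda>j. if j \<in> T then y j else 0) \<le> lam' * (\<Sum>j<n. (if j \<in> T then y j else 0)\<^sup>2)"
      by (subst G'w, simp add: T_def, rule ray')
  qed (auto simp: T_def)
  have "m\<^sup>2 * (real (card T) - 1) = m\<^sup>2 * real n - 2 * m\<^sup>2" unfolding cT by (simp add: algebra_simps)
  then have lam': "0 < lam'" using low' small \<open>real n * m \<ge> 0\<close> B_nonneg m2pos by (simp add: algebra_simps)
  note loo = leave_one_out_identity[where G = ?G and u = ?u and u' = ?u', OF gram_entry_sym i eq ray eq' u'1 lam']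
  have low: "m\<^sup>2 * (real n - 1) - 24 * real n * m - 8 * B \<le> lam"
    using rayleigh_lower[of "{..<n}" lam, OF _ _ ray] n by (simp add: lessThan_empty_iff)
  have al: "m\<^sup>2 * real n - 48 * real n * m - 16 * B \<le> m\<^sup>2 * (align ?u)\<^sup>2"
    by (rule alignment[OF low u1 qu])
  have al': "m\<^sup>2 * (real n - 1) - 48 * real n * m - 16 * B \<le> m\<^sup>2 * (align ?u')\<^sup>2"
    using alignment[OF low' u'1] G'w[of ?u'] loo(1) qu' by (simp add: cT)
  have "m\<^sup>2 * real n < 2 * (m\<^sup>2 * (align ?u)\<^sup>2)"
    using al small m2pos by linarith
  then have big: "real n / 2 < (align ?u)\<^sup>2" using m2pos by (simp add: mult.left_commute[of 2])
  have "m\<^sup>2 * real n < 2 * (m\<^sup>2 * (align ?u')\<^sup>2)"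
    using al' small m2pos by (simp only: right_diff_distrib mult_1_right)
  then have big': "real n / 2 < (align ?u')\<^sup>2" using m2pos by (simp add: mult.left_commute[of 2])
  have inner: "sgn (\<Sum>j<n. ?u j * ?u' j) = sgn (align ?u) * sgn (align ?u')"
    unfolding align_def
    using inner_product_sign_of_aligned[of n y ?u ?u'] n y2 u1 u'1 big big' by (simp add: align_def)
  have qx: "q l = (\<Sum>j<n. ?u' j * data_x y mu z j l)" if "l < d" for l
    unfolding q using loo(1) that by (intro sum.cong refl) (auto simp: data_x_reset_row)
  define P where "P = (\<Sum>l<d. mu l * q l)"
  define W where "W = (\<Sum>l<d. z (i, l) * q l)"
  have "(\<Sum>k<n. ?G i k * ?u' k) = (\<Sum>k<n. \<Sum>l<d. data_x y mu z i l * (?u' k * data_x y mu z k l))"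
    using loo(1) by (intro sum.cong refl) (auto simp: gram_entry_def sum_distrib_left mult_ac)
  also have "\<dots> = (\<Sum>l<d. \<Sum>k<n. data_x y mu z i l * (?u' k * data_x y mu z k l))" by (rule sum.swap)
  also have "\<dots> = (\<Sum>l<d. data_x y mu z i l * q l)"
    by (intro sum.cong refl) (simp add: qx sum_distrib_left)
  also have "\<dots> = (\<Sum>l<d. y i * (mu l * q l) + z (i, l) * q l)"
    unfolding data_x_def by (intro sum.cong refl) (simp only: algebra_simps)
  also have "\<dots> = y i * P + W" by (simp only: sum.distrib sum_distrib_left[symmetric] P_def W_def)
  finally have c: "(\<Sum>k<n. ?G i k * ?u' k) = y i * P + W" .
  have "P = (\<Sum>l<d. align ?u' * (mu l)\<^sup>2 + mu l * (\<Sum>j<n. ?u' j * z (j, l)))"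
    unfolding P_def by (intro sum.cong refl) (simp only: qx lessThan_iff data_combination power2_eq_square algebra_simps)
  also have "\<dots> = align ?u' * m\<^sup>2 + (\<Sum>j<n. ?u' j * proj j)"
    by (simp only: sum.distrib sum_distrib_left[symmetric] m2 proj_combination)
  finally have P: "P = align ?u' * m\<^sup>2 + (\<Sum>j<n. ?u' j * proj j)" .
  have pr: "\<bar>\<Sum>j<n. ?u' j * proj j\<bar> \<le> 6 * sqrt n * m"
    using proj_combination_le[of ?u' 1] u'1 by simp
  have eta1: "real n * m\<^sup>2 * \<eta> = m\<^sup>2 + 48 * real n * m + 16 * B" using n m_pos by (simp add: eta)
  have eta0: "0 \<le> \<eta>" unfolding eta using B_nonneg m_pos by simp
  have etale: "0 < 1 - \<eta>"
  proof (rule ccontr)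
    assume "\<not> 0 < 1 - \<eta>"
    then have "m\<^sup>2 * (1 - \<eta>) \<le> 0" using m2pos by (simp add: mult_le_0_iff)
    then show False using pos m_pos by linarith
  qed
  have "m\<^sup>2 * (n * (1 - \<eta>)) \<le> m\<^sup>2 * (align ?u')\<^sup>2" using al' eta1 by (simp add: algebra_simps)
  then have "n * (1 - \<eta>) \<le> (align ?u')\<^sup>2" using m2pos by (simp only: mult_le_cancel_left_pos)
  \<comment> \<open>Weakening \<open>1 - \<eta>\<close> to its square avoids a square root of
    \<open>1 - \<eta>\<close> in the bound for the alignment.\<close>
  moreover have "(1 - \<eta>) * (1 - \<eta>) \<le> (1 - \<eta>) * 1" using eta0 etale by (intro mult_left_mono) auto
  then have "n * (1 - \<eta>)\<^sup>2 \<le> n * (1 - \<eta>)" by (intro mult_left_mono) (auto simp: power2_eq_square)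
  ultimately have "n * (1 - \<eta>)\<^sup>2 \<le> (align ?u')\<^sup>2" by linarith
  then have "(sqrt n * (1 - \<eta>))\<^sup>2 \<le> (align ?u')\<^sup>2" by (simp add: power_mult_distrib)
  then have al_abs: "sqrt n * (1 - \<eta>) \<le> \<bar>align ?u'\<bar>"
    using etale abs_le_square_iff[of "sqrt n * (1 - \<eta>)" "align ?u'"] by simp
  have "sqrt n * (1 - \<eta>) * m\<^sup>2 \<le> \<bar>align ?u'\<bar> * m\<^sup>2" by (intro mult_right_mono al_abs) auto
  then have strong: "sqrt n * (m\<^sup>2 * (1 - \<eta>) - 6 * m) \<le> \<bar>align ?u' * m\<^sup>2\<bar> - 6 * sqrt n * m"
    by (simp add: abs_mult algebra_simps)
  have Kpos: "0 < sqrt n * (m\<^sup>2 * (1 - \<eta>) - 6 * m)" using pos n by simp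
  have Pge: "sqrt n * (m\<^sup>2 * (1 - \<eta>) - 6 * m) \<le> \<bar>P\<bar>" using strong pr unfolding P by linarith
  have sgnP: "sgn P = sgn (align ?u')"
  proof (cases "0 < align ?u'")
    case True
    then have "0 < align ?u' * m\<^sup>2" using m2pos by simp
    then have "0 < P" using strong Kpos pr unfolding P by linarith
    then show ?thesis using True by simp
  next
    case False
    then have "align ?u' * m\<^sup>2 \<le> 0" using m2pos by (simp add: mult_le_0_iff)
    then have "P < 0" "align ?u' * m\<^sup>2 < 0" using strong Kpos pr unfolding P by linarith+
    then show ?thesis using m2pos by (simp add: mult_less_0_iff)
  qed
  \<comment> \<open>If the noise part \<open>W\<close> were smaller, the factor in the leave-one-out
    identity would have the sign of \<open>y i * P\<close>. The sign of the alignment of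
    \<open>u'\<close> then cancels, and \<open>u\<close> has the correct sign at
    \<open>i\<close>.\<close>
  have WP: "\<bar>P\<bar> \<le> \<bar>W\<bar>"
  proof (rule ccontr)
    assume "\<not> \<bar>P\<bar> \<le> \<bar>W\<bar>"
    then have dom: "\<bar>W\<bar> < \<bar>y i * P\<bar>" using y2[OF i] by (simp add: abs_mult)
    have "sgn (y i * P + W) = sgn (y i * P)"
    proof (cases "0 < y i * P")
      case True
      then have "0 < y i * P + W" using dom by linarith
      then show ?thesis using True by (simp only: sgn_pos)
    next
      case False
      then have "y i * P + W < 0" "y i * P < 0" using dom by linarith+
      then show ?thesis by (simp only: sgn_neg)
    qed
    then have sc: "sgn (y i * P + W) = y i * sgn P" "y i * P + W \<noteq> 0"
      using y[OF i] dom by (auto simp: sgn_mult)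
    then have lt: "lam' < lam" using loo(3) c by simp
    have "?u i * (y i * P + W) = (lam - lam') * (\<Sum>j<n. ?u j * ?u' j)" using loo(2) c by simp
    then have "sgn (?u i) * sgn (y i * P + W) = sgn (lam - lam') * sgn (\<Sum>j<n. ?u j * ?u' j)"
      by (metis sgn_mult)
    then have "sgn (?u i) * (y i * sgn (align ?u')) = sgn (align ?u) * sgn (align ?u')"
      using lt by (simp add: sc inner sgnP)
    moreover have "sgn (align ?u') \<noteq> 0" using big' n by (auto simp: sgn_zero_iff)
    ultimately have "sgn (?u i) * y i = sgn (align ?u)" by (simp add: mult.assoc[symmetric])
    moreover have "sgn (align ?u) = (if 0 \<le> align ?u then 1 else - 1)"
      using big n by (auto simp: sgn_if)
    ultimately show False using wrong y[OF i] by (auto split: if_splits)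
  qed
  \<comment> \<open>The main part is \<open>n * (m\<^sup>2 + d / n)\<close>, that is,
    \<open>n\<close> times the denominator of \<open>SNR\<close>; the square of the lower bound for
    \<open>P\<close> is, up to errors, \<open>n\<close> times its numerator.\<close>
  have qn: "(\<Sum>l<d. (q l)\<^sup>2) \<le> real n * m\<^sup>2 + 12 * real n * m + d + 9 * B"
  proof -
    have "(\<Sum>l<d. (q l)\<^sup>2) = (align ?u')\<^sup>2 * m\<^sup>2 + 2 * align ?u' * (\<Sum>j<n. ?u' j * proj j) + (\<Sum>l<d. (\<Sum>j<n. ?u' j * z (j, l))\<^sup>2)"
      using data_combination_norm[of ?u'] by (simp add: qx)
    moreover have ab: "\<bar>align ?u'\<bar> \<le> sqrt n" using align_le[of ?u' 1] u'1 by simp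
    then have "(align ?u')\<^sup>2 \<le> (sqrt n)\<^sup>2" using abs_le_square_iff[of "align ?u'" "sqrt n"] by simp
    then have "(align ?u')\<^sup>2 * m\<^sup>2 \<le> real n * m\<^sup>2" by (intro mult_right_mono) auto
    moreover have "\<bar>align ?u' * (\<Sum>j<n. ?u' j * proj j)\<bar> \<le> sqrt n * (6 * sqrt n * m)"
      unfolding abs_mult using ab pr m_pos by (intro mult_mono) auto
    then have "2 * align ?u' * (\<Sum>j<n. ?u' j * proj j) \<le> 12 * real n * m"
    proof -
      assume "\<bar>align ?u' * (\<Sum>j<n. ?u' j * proj j)\<bar> \<le> sqrt n * (6 * sqrt n * m)"
      moreover have "sqrt n * (6 * sqrt n * m) = 6 * ((sqrt n * sqrt n) * m)" by (simp only: mult_ac)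
      then have "sqrt n * (6 * sqrt n * m) = 6 * (real n * m)" unfolding sqrt_n(2) .
      ultimately have "align ?u' * (\<Sum>j<n. ?u' j * proj j) \<le> 6 * (real n * m)" by linarith
      then show ?thesis by (simp add: mult.assoc mult.commute[of m])
    qed
    ultimately show ?thesis using noise_norm_le[of ?u'] u'1 by linarith
  qed
  have "P \<noteq> 0" using Pge Kpos by linarith
  have qpos: "0 < (\<Sum>l<d. (q l)\<^sup>2)"
  proof (rule ccontr)
    assume "\<not> 0 < (\<Sum>l<d. (q l)\<^sup>2)"
    moreover have "0 \<le> (\<Sum>l<d. (q l)\<^sup>2)" by (simp add: sum_nonneg)
    ultimately have "(\<Sum>l<d. (q l)\<^sup>2) = 0" by linarith
    then have "q l = 0" if "l < d" for l using that by (simp add: sum_nonneg_eq_0_iff)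
    then have "P = 0" by (simp add: P_def)
    then show False using \<open>P \<noteq> 0\<close> by simp
  qed
  have "(\<kappa> * sqrt (\<Sum>l<d. (q l)\<^sup>2))\<^sup>2 = \<kappa>\<^sup>2 * (\<Sum>l<d. (q l)\<^sup>2)"
    using qpos by (simp add: power_mult_distrib)
  also have "\<dots> \<le> \<kappa>\<^sup>2 * (real n * m\<^sup>2 + 12 * real n * m + d + 9 * B)" by (intro mult_left_mono qn) simp
  also note \<kappa>(2)
  also have "n * (m\<^sup>2 * (1 - \<eta>) - 6 * m)\<^sup>2 = (sqrt n * (m\<^sup>2 * (1 - \<eta>) - 6 * m))\<^sup>2" by (simp add: power_mult_distrib)
  finally have "\<kappa> * sqrt (\<Sum>l<d. (q l)\<^sup>2) \<le> sqrt n * (m\<^sup>2 * (1 - \<eta>) - 6 * m)"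
    by (rule power2_le_imp_le) (use Kpos in simp)
  then show ?thesis using qpos Pge WP by (simp add: W_def)
qed

end

section \<open>From the signal-to-noise ratio to explicit error margins\<close>

lemma SNR_le_signal:
  assumes "m = sqrt (\<Sum>l<d. (mu l)\<^sup>2)" "0 < SNR n d mu" "0 < n"
  shows "0 < m" "SNR n d mu \<le> m\<^sup>2" "SNR n d mu * (m\<^sup>2 + d / n) = m\<^sup>2 * m\<^sup>2" "SNR n d mu * (d / n) \<le> m\<^sup>2 * m\<^sup>2"
proof -
  have m2: "(\<Sum>l<d. (mu l)\<^sup>2) = m\<^sup>2" unfolding assms(1) by (simp add: sum_nonneg)
  have S: "SNR n d mu = (m\<^sup>2)\<^sup>2 / (m\<^sup>2 + d / n)" unfolding SNR_def m2 ..
  have "m \<noteq> 0" using assms(2) S by auto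
  moreover have "0 \<le> m" unfolding assms(1) by (simp add: sum_nonneg)
  ultimately show m: "0 < m" by simp
  have den: "0 < m\<^sup>2 + d / n" using m by (simp add: add_pos_nonneg)
  then show eq: "SNR n d mu * (m\<^sup>2 + d / n) = m\<^sup>2 * m\<^sup>2"
    unfolding S by (simp add: power2_eq_square)
  have dn: "0 \<le> SNR n d mu * (d / n)" "0 \<le> SNR n d mu * m\<^sup>2" using assms(2) by simp_all
  show "SNR n d mu * (d / n) \<le> m\<^sup>2 * m\<^sup>2" using eq dn unfolding distrib_left by linarith
  have "SNR n d mu * m\<^sup>2 \<le> m\<^sup>2 * m\<^sup>2" using eq dn unfolding distrib_left by linarith
  then show "SNR n d mu \<le> m\<^sup>2" using m by (simp only: mult_le_cancel_right_pos zero_less_power)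
qed

text \<open>All errors are measured in units of \<open>n * m\<^sup>2\<close>, with \<open>r\<close>
  as the small parameter. The terms \<open>sqrt (n * d)\<close> and \<open>n\<close> each cost at
  most \<open>r\<close> of this unit, hence 30 + 30 = 60.\<close>

lemma SNR_noise_bound:
  assumes m: "m = sqrt (\<Sum>l<d. (mu l)\<^sup>2)" and n: "0 < n" and S: "1 \<le> SNR n d mu" and r: "r = 1 / sqrt (SNR n d mu)"
  shows "m \<le> m\<^sup>2 * r" "noise_bound n d \<le> 60 * (real n * m\<^sup>2 * r)" "0 < r" "r \<le> 1"
proof -
  define T where "T = SNR n d mu"
  have T: "1 \<le> T" "0 < T" using S by (auto simp: T_def)
  note f = SNR_le_signal[OF m _ n, folded T_def, OF T(2)]
  show r0: "0 < r" and r1: "r \<le> 1" using T by (auto simp: r T_def[symmetric])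
  have rT: "r\<^sup>2 * T = 1" using T by (simp add: r T_def[symmetric] power_divide)
  have "sqrt T \<le> m" using f(1,2) by (simp add: real_le_lsqrt)
  then have rm: "1 \<le> m * r" using T by (simp add: r T_def[symmetric])
  then have "m * 1 \<le> m * (m * r)" using f(1) by (intro mult_left_mono) auto
  then show "m \<le> m\<^sup>2 * r" by (simp add: power2_eq_square mult.assoc)
  have "d / n = r\<^sup>2 * (T * (d / n))" using rT by (simp add: mult.assoc[symmetric])
  also have "\<dots> \<le> r\<^sup>2 * (m\<^sup>2 * m\<^sup>2)" by (intro mult_left_mono f(4)) simp
  also have "\<dots> = (m\<^sup>2 * r)\<^sup>2" by (simp add: power2_eq_square mult_ac)
  finally have dn: "d / n \<le> (m\<^sup>2 * r)\<^sup>2" .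
  have "sqrt (real n * real d) = n * sqrt (d / n)"
  proof -
    have "real n * real d = real n ^ 2 * (d / n)" using n by (simp add: power2_eq_square)
    then show ?thesis by (simp add: real_sqrt_mult del: times_divide_eq_right)
  qed
  also have "\<dots> \<le> n * (m\<^sup>2 * r)"
    using dn r0 by (intro mult_left_mono) (auto intro!: real_le_lsqrt)
  finally have 1: "sqrt (real n * real d) \<le> real n * m\<^sup>2 * r" by (simp add: mult.assoc)
  have "1 * 1 \<le> (m * r) * (m * r)" using rm by (intro mult_mono) auto
  also have "\<dots> = m\<^sup>2 * r * r" by (simp add: power2_eq_square mult_ac)
  also have "\<dots> \<le> m\<^sup>2 * r * 1" using r0 r1 by (intro mult_left_mono) auto
  finally have "1 \<le> m\<^sup>2 * r" by simp
  then have "real n * 1 \<le> real n * (m\<^sup>2 * r)" by (intro mult_left_mono) auto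
  then show "noise_bound n d \<le> 60 * (real n * m\<^sup>2 * r)"
    using 1 by (simp add: noise_bound_def mult.assoc)
qed

text \<open>With \<open>r = 1 / sqrt SNR\<close>, the loss \<open>\<eta>\<close> is at most
  \<open>1 / n + 1008 * r\<close>, where 1008 = 48 + 16 * 60. The term \<open>6 * m\<close> costs
  another \<open>6 * r\<close>, and the excess length of \<open>q\<close> costs the factor
  \<open>1 + 552 * r\<close>, where 552 = 12 + 9 * 60. Half of 552 is 276, and 2580 = 2 * (1008 + 6
  + 276).\<close>

lemma SNR_margin:
  assumes m: "m = sqrt (\<Sum>l<d. (mu l)\<^sup>2)" and n: "2 \<le> n" and S: "1 \<le> SNR n d mu"
    and \<delta>: "2 / real n + 2580 / sqrt (SNR n d mu) \<le> \<delta>" "\<delta> \<le> 1 / 4"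
    and eta: "\<eta> = (m\<^sup>2 + 48 * real n * m + 16 * noise_bound n d) / (real n * m\<^sup>2)"
  shows "2 * m\<^sup>2 + 96 * real n * m + 32 * noise_bound n d < m\<^sup>2 * real n"
    and "0 < m\<^sup>2 * (1 - \<eta>) - 6 * m"
    and "(1 - \<delta>) * SNR n d mu * (real n * m\<^sup>2 + 12 * real n * m + d + 9 * noise_bound n d) \<le> n * (m\<^sup>2 * (1 - \<eta>) - 6 * m)\<^sup>2"
proof -
  define T where "T = SNR n d mu"
  define r where "r = 1 / sqrt T"
  define N where "N = real n"
  have N: "0 < N" "0 < n" using n by (auto simp: N_def)
  have T: "1 \<le> T" "0 < T" using S by (auto simp: T_def)
  note f = SNR_le_signal[OF m _ N(2), folded T_def, OF T(2)]
  note g = SNR_noise_bound[OF m N(2) S r_def[unfolded T_def]]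
  have \<delta>': "2 / N + 2580 * r \<le> \<delta>" using \<delta>(1) by (simp add: r_def T_def N_def)
  have m2: "0 < m\<^sup>2" using f(1) by simp
  have Nm: "0 < N * m\<^sup>2" using N m2 by simp
  have nm: "N * m \<le> N * m\<^sup>2 * r" using g(1) N by (simp add: mult.assoc)
  have eta1: "N * m\<^sup>2 * \<eta> = m\<^sup>2 + 48 * (N * m) + 16 * noise_bound n d"
    unfolding eta N_def[symmetric] using N(1) f(1) by simp
  have "N * m\<^sup>2 * \<eta> \<le> m\<^sup>2 + 1008 * (N * m\<^sup>2 * r)" using eta1 nm g(2)[folded N_def] by linarith
  also have "\<dots> = N * m\<^sup>2 * (1 / N + 1008 * r)" using N by (simp add: field_simps)
  finally have "\<eta> \<le> 1 / N + 1008 * r" using Nm by (simp only: mult_le_cancel_left_pos)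
  then have eta2: "\<eta> \<le> \<delta> / 2 - 282 * r" using \<delta>' by (simp add: field_simps)
  then have "\<eta> < 1 / 2" using \<delta>(2) g(3) by linarith
  then have "N * m\<^sup>2 * \<eta> < N * m\<^sup>2 * (1 / 2)" using Nm by (simp only: mult_less_cancel_left_pos)
  then show "2 * m\<^sup>2 + 96 * real n * m + 32 * noise_bound n d < m\<^sup>2 * real n"
    unfolding eta1 by (simp add: N_def mult.assoc mult.commute[of "m\<^sup>2"])
  have low: "m\<^sup>2 * (1 - \<delta> / 2 + 276 * r) \<le> m\<^sup>2 * (1 - \<eta>) - 6 * m"
  proof -
    have "m\<^sup>2 * (1 - \<delta> / 2 + 276 * r) \<le> m\<^sup>2 * (1 - \<eta> - 6 * r)" using m2 eta2 by (intro mult_left_mono) auto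
    also have "\<dots> = m\<^sup>2 * (1 - \<eta>) - 6 * (m\<^sup>2 * r)" by (simp add: algebra_simps)
    finally show ?thesis using g(1) by linarith
  qed
  have pos: "0 < 1 - \<delta> / 2 + 276 * r" using \<delta>(2) g(3) by linarith
  then have lpos: "0 < m\<^sup>2 * (1 - \<delta> / 2 + 276 * r)" using m2 by simp
  then show "0 < m\<^sup>2 * (1 - \<eta>) - 6 * m" using low by linarith
  have "0 < 2 / N" using N by simp
  then have d0: "0 \<le> \<delta>" using \<delta>' g(3) by linarith
  have "N * m\<^sup>2 + 12 * (N * m) + d + 9 * noise_bound n d \<le> N * m\<^sup>2 + d + 552 * r * (N * m\<^sup>2)"
    using nm g(2)[folded N_def] by (simp add: mult_ac) 
  also have "\<dots> \<le> N * m\<^sup>2 + d + 552 * r * (N * m\<^sup>2 + d)" using g(3) by simp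
  also have "\<dots> = (1 + 552 * r) * (N * (m\<^sup>2 + d / n))" using N by (simp add: N_def algebra_simps)
  finally have "(1 - \<delta>) * T * (N * m\<^sup>2 + 12 * (N * m) + d + 9 * noise_bound n d)
      \<le> (1 - \<delta>) * T * ((1 + 552 * r) * (N * (m\<^sup>2 + d / n)))"
    using \<delta>(2) T by (intro mult_left_mono) auto
  also have "\<dots> = ((1 - \<delta>) * (1 + 552 * r)) * (N * (T * (m\<^sup>2 + d / n)))" by (simp only: mult_ac)
  also have "\<dots> = ((1 - \<delta>) * (1 + 552 * r)) * (N * (m\<^sup>2 * m\<^sup>2))" unfolding f(3) ..
  also have "\<dots> \<le> (1 - \<delta> / 2 + 276 * r)\<^sup>2 * (N * (m\<^sup>2 * m\<^sup>2))"
  proof (rule mult_right_mono)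
    \<comment> \<open>Expanding the square reproduces \<open>1 - \<delta> + 552 * r\<close> exactly;
      what remains is a square on one side and a negative product on the other.\<close>
    have "0 \<le> (\<delta> / 2 - 276 * r)\<^sup>2" "0 \<le> \<delta> * r" using d0 g(3) by auto
    moreover have "(1 - \<delta> / 2 + 276 * r)\<^sup>2 = 1 - \<delta> + 552 * r + (\<delta> / 2 - 276 * r)\<^sup>2"
      by (simp add: power2_eq_square algebra_simps)
    moreover have "(1 - \<delta>) * (1 + 552 * r) = 1 - \<delta> + 552 * r - 552 * (\<delta> * r)" by (simp add: algebra_simps)
    ultimately show "(1 - \<delta>) * (1 + 552 * r) \<le> (1 - \<delta> / 2 + 276 * r)\<^sup>2" by linarith
  qed (use N in auto)
  also have "\<dots> = N * (m\<^sup>2 * (1 - \<delta> / 2 + 276 * r))\<^sup>2" by (simp add: power_mult_distrib power2_eq_square mult_ac)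
  also have "\<dots> \<le> N * (m\<^sup>2 * (1 - \<eta>) - 6 * m)\<^sup>2"
    using N low lpos by (intro mult_left_mono power_mono) auto
  finally show "(1 - \<delta>) * SNR n d mu * (real n * m\<^sup>2 + 12 * real n * m + d + 9 * noise_bound n d) \<le> n * (m\<^sup>2 * (1 - \<eta>) - 6 * m)\<^sup>2"
    by (simp add: N_def T_def mult.assoc)
qed

section \<open>Probability bounds\<close>

text \<open>Lets \<open>u\<close> be evaluated at the modified array: the composition is measurable
  and stays in the sample space.\<close>

lemma reset_row_measurable:
  assumes "i < n"
  shows "reset_row d y mu i \<in> measurable (noise_space n d) (noise_space n d)"
  unfolding noise_space_def
proof (rule measurable_PiM_single')
  fix p assume p: "p \<in> {..<n} \<times> {..<d}"
  obtain j l where jl: "p = (j, l)" by (cases p)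
  show "(\<lambda>z. reset_row d y mu i z p) \<in> measurable (Pi\<^sub>M ({..<n} \<times> {..<d}) (\<lambda>_. std_normal)) std_normal"
  proof (cases "j = i \<and> l < d")
    case True
    then show ?thesis by (simp add: reset_row_def jl)
  next
    case False
    then have "reset_row d y mu i z p = z p" for z by (auto simp: reset_row_def jl)
    then show ?thesis using measurable_component_singleton[OF p] by simp
  qed
next
  show "(\<lambda>z. reset_row d y mu i z) \<in> space (Pi\<^sub>M ({..<n} \<times> {..<d}) (\<lambda>_. std_normal)) \<rightarrow> (\<Pi>\<^sub>E p\<in>{..<n} \<times> {..<d}. space std_normal)"
    using assms by (auto simp: space_PiM PiE_def extensional_def reset_row_def)
qed

lemma reset_row_cong:
  assumes z: "z \<in> space (noise_space n d)" "z' \<in> space (noise_space n d)"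
    and eq: "\<And>j l. j < n \<Longrightarrow> j \<noteq> i \<Longrightarrow> l < d \<Longrightarrow> z (j, l) = z' (j, l)"
  shows "reset_row d y mu i z = reset_row d y mu i z'"
proof
  fix p :: "nat \<times> nat"
  obtain j l where jl: "p = (j, l)" by (cases p)
  have "z (j, l) = z' (j, l)" if "\<not> (j = i \<and> l < d)"
  proof (cases "j < n \<and> l < d")
    case True
    then show ?thesis using that eq by auto
  next
    case False
    then show ?thesis using z by (auto simp: noise_space_def space_PiM PiE_def extensional_def)
  qed
  then show "reset_row d y mu i z p = reset_row d y mu i z' p" by (simp add: reset_row_def jl)
qed

lemma misclass_le_1: "0 < n \<Longrightarrow> misclass n f y \<le> 1"
proof -
  assume n: "0 < n"
  have "card {i \<in> {..<n}. f i \<noteq> y i} \<le> card {..<n}" by (intro card_mono) auto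
  then have "real (min (card {i \<in> {..<n}. f i \<noteq> y i}) (card {i \<in> {..<n}. f i \<noteq> - y i})) \<le> real n" by simp
  then show ?thesis unfolding misclass_def using n by (simp add: field_simps)
qed

lemma misclass_le_of_sign:
  assumes s: "s = 1 \<or> s = - 1" and sub: "\<And>i. i < n \<Longrightarrow> f i \<noteq> s * y i \<Longrightarrow> i \<in> W"
  shows "misclass n f y \<le> (1 / real n) * real (card ({..<n} \<inter> W))"
proof -
  have "card {i \<in> {..<n}. f i \<noteq> s * y i} \<le> card ({..<n} \<inter> W)"
    using sub by (intro card_mono) auto
  moreover have "min (card {i \<in> {..<n}. f i \<noteq> y i}) (card {i \<in> {..<n}. f i \<noteq> - y i}) \<le> card {i \<in> {..<n}. f i \<noteq> s * y i}"
    using s by auto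
  ultimately show ?thesis unfolding misclass_def by (intro mult_left_mono of_nat_mono) auto
qed

text \<open>Collects all randomness in one global event \<open>Bad\<close> and one event
  \<open>A i\<close> per index. Both the expectation bound and the exact recovery bound follow from
  these by summation.\<close>

lemma misclassification_events:
  fixes u :: "((nat \<times> nat) \<Rightarrow> real) \<Rightarrow> real vec"
  assumes n: "2 \<le> n" and d: "0 < d" and y: "\<And>i. i < n \<Longrightarrow> y i \<in> {-1, 1}"
    and lead: "\<And>z. z \<in> space (noise_space n d) \<Longrightarrow> leading_unit_eigvec (hollow_gram n d y mu z) (u z)"
    and meas: "\<And>i. i < n \<Longrightarrow> (\<lambda>z. vec_index (u z) i) \<in> borel_measurable (noise_space n d)"
    and S: "1 \<le> SNR n d mu" and \<delta>: "2 / real n + 2580 / sqrt (SNR n d mu) \<le> \<delta>" "\<delta> \<le> 1 / 4"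
  obtains Bad A where "Bad \<in> sets (noise_space n d)" "measure (noise_space n d) Bad \<le> 4 * exp (- real n)"
    "\<And>i. i < n \<Longrightarrow> A i \<in> sets (noise_space n d)"
    "\<And>i. i < n \<Longrightarrow> measure (noise_space n d) (A i) \<le> 2 * exp (- ((1 - \<delta>) * SNR n d mu / 2))"
    "\<And>z. z \<in> space (noise_space n d) - Bad \<Longrightarrow>
        misclass n (\<lambda>i. sgn (vec_index (u z) i)) y \<le> (1 / real n) * real (card ({..<n} \<inter> {i. z \<in> A i}))"
proof -
  define m where "m = sqrt (\<Sum>l<d. (mu l)\<^sup>2)"
  have n0: "0 < n" using n by simp
  have mpos: "0 < m" by (rule SNR_le_signal[OF m_def _ n0]) (use S in simp)
  then have m2: "0 < (\<Sum>l<d. (mu l)\<^sup>2)" by (simp add: m_def)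
  obtain Bad where Bad: "Bad \<in> sets (noise_space n d)" "measure (noise_space n d) Bad \<le> 4 * exp (- real n)"
    "\<And>z. z \<in> space (noise_space n d) - Bad \<Longrightarrow> regular_noise n d mu z"
    by (rule regular_noise_prob[OF n0 d m2]) (rule that)
  \<comment> \<open>The largest threshold that \<open>SNR_margin\<close> permits; its Gaussian tail
    has the target exponent up to the factor \<open>1 - \<delta>\<close>.\<close>
  define \<kappa> where "\<kappa> = sqrt ((1 - \<delta>) * SNR n d mu)"
  have kk: "\<kappa>\<^sup>2 = (1 - \<delta>) * SNR n d mu" "0 \<le> \<kappa>" using \<delta>(2) S by (auto simp: \<kappa>_def)
  define q where "q i z l = (\<Sum>j<n. vec_index (u (reset_row d y mu i z)) j * data_x y mu (reset_row d y mu i z) j l)" for i z l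
  define A where "A i = {z \<in> space (noise_space n d). 0 < (\<Sum>l<d. (q i z l)\<^sup>2)
      \<and> \<kappa> * sqrt (\<Sum>l<d. (q i z l)\<^sup>2) \<le> \<bar>\<Sum>l<d. z (i, l) * q i z l\<bar>}" for i
  have qm: "(\<lambda>z. q i z l) \<in> borel_measurable (noise_space n d)" if "i < n" "l < d" for i l
    unfolding q_def
  proof (intro borel_measurable_sum borel_measurable_times)
    fix j assume j: "j \<in> {..<n}"
    note comp = measurable_compose[OF reset_row_measurable[OF that(1), of d y mu]]
    show "(\<lambda>z. vec_index (u (reset_row d y mu i z)) j) \<in> borel_measurable (noise_space n d)"
      by (rule comp[OF meas]) (use j in simp)
    have "(\<lambda>z. data_x y mu z j l) \<in> borel_measurable (noise_space n d)"
      unfolding data_x_def using j that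
      by (intro borel_measurable_add borel_measurable_const borel_measurable_noise_component) auto
    then show "(\<lambda>z. data_x y mu (reset_row d y mu i z) j l) \<in> borel_measurable (noise_space n d)"
      by (rule comp)
  qed
  show thesis
  proof (rule that[OF Bad(1,2)])
    fix i assume i: "i < n"
    define f where "f z = (\<Sum>l<d. z (i, l) * q i z l)" for z
    define g where "g z = (\<Sum>l<d. (q i z l)\<^sup>2)" for z
    have [measurable]: "f \<in> borel_measurable (noise_space n d)"
      unfolding f_def using i by (intro borel_measurable_sum borel_measurable_times borel_measurable_noise_component qm) auto
    have [measurable]: "g \<in> borel_measurable (noise_space n d)"
      unfolding g_def using i by (intro borel_measurable_sum borel_measurable_power qm) auto
    have "(\<lambda>z. \<kappa> * sqrt (g z)) \<in> borel_measurable (noise_space n d)" "(\<lambda>z. \<bar>f z\<bar>) \<in> borel_measurable (noise_space n d)"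
      by measurable
    from borel_measurable_le[OF this]
    have "{z \<in> space (noise_space n d). \<kappa> * sqrt (g z) \<le> \<bar>f z\<bar>} \<in> sets (noise_space n d)" .
    then show "A i \<in> sets (noise_space n d)" unfolding A_def f_def[symmetric] g_def[symmetric]
      by (intro sets.sets_Collect_conj) measurable
    have "measure (noise_space n d) (A i) \<le> 2 * exp (- (\<kappa>\<^sup>2 / 2))"
      unfolding A_def
    proof (rule noise_row_tail[OF i kk(2)])
      show "(\<lambda>z. q i z l) \<in> borel_measurable (noise_space n d)" if "l < d" for l by (rule qm[OF i that])
      show "q i z = q i z'" if "z \<in> space (noise_space n d)" "z' \<in> space (noise_space n d)"
        "\<And>j l. j < n \<Longrightarrow> j \<noteq> i \<Longrightarrow> l < d \<Longrightarrow> z (j, l) = z' (j, l)" for z z'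
        unfolding q_def[abs_def] using reset_row_cong[OF that] by simp
    qed
    then show "measure (noise_space n d) (A i) \<le> 2 * exp (- ((1 - \<delta>) * SNR n d mu / 2))" by (simp add: kk)
  next
    fix z assume z: "z \<in> space (noise_space n d) - Bad"
    interpret regular_instance n d y mu z m
      by unfold_locales (use n y Bad(3)[OF z] mpos in \<open>auto simp: m_def\<close>)
    note margin = SNR_margin[OF m_def n S \<delta> refl]
    have wrong: "i \<in> {i. z \<in> A i}"
      if i: "i < n" and w: "sgn (vec_index (u z) i) \<noteq> (if 0 \<le> align (vec_index (u z)) then 1 else - 1) * y i" for i
    proof -
      have "reset_row d y mu i z \<in> space (noise_space n d)"
        using measurable_space[OF reset_row_measurable[OF i]] z by blast
      note l' = lead[OF this]
      have "0 < (\<Sum>l<d. (q i z l)\<^sup>2) \<and> \<kappa> * sqrt (\<Sum>l<d. (q i z l)\<^sup>2) \<le> \<bar>\<Sum>l<d. z (i, l) * q i z l\<bar>"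
        using z kk margin w
        by (intro misclassified_large_deviation[OF i lead l' _ refl]) (auto simp: q_def fun_eq_iff)
      then show ?thesis using z by (simp add: A_def)
    qed
    show "misclass n (\<lambda>i. sgn (vec_index (u z) i)) y \<le> (1 / real n) * real (card ({..<n} \<inter> {i. z \<in> A i}))"
      by (rule misclass_le_of_sign[OF _ wrong]) auto
  qed
qed

lemma expectation_misclass_le:
  fixes u :: "((nat \<times> nat) \<Rightarrow> real) \<Rightarrow> real vec"
  assumes n: "2 \<le> n" and d: "0 < d" and y: "\<And>i. i < n \<Longrightarrow> y i \<in> {-1, 1}"
    and lead: "\<And>z. z \<in> space (noise_space n d) \<Longrightarrow> leading_unit_eigvec (hollow_gram n d y mu z) (u z)"
    and meas: "\<And>i. i < n \<Longrightarrow> (\<lambda>z. vec_index (u z) i) \<in> borel_measurable (noise_space n d)"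
    and S: "1 \<le> SNR n d mu" and \<delta>: "2 / real n + 2580 / sqrt (SNR n d mu) \<le> \<delta>" "\<delta> \<le> 1 / 4"
  shows "(\<integral>z. misclass n (\<lambda>i. sgn (vec_index (u z) i)) y \<partial>noise_space n d)
    \<le> 4 * exp (- real n) + 2 * exp (- ((1 - \<delta>) * SNR n d mu / 2))"
proof -
  let ?M = "noise_space n d"
  let ?e = "2 * exp (- ((1 - \<delta>) * SNR n d mu / 2))"
  interpret P: prob_space ?M unfolding noise_space_def by (rule prob_space_PiM_std_normal)
  obtain Bad A where Bad: "Bad \<in> sets ?M" "measure ?M Bad \<le> 4 * exp (- real n)"
    and A: "\<And>i. i < n \<Longrightarrow> A i \<in> sets ?M" "\<And>i. i < n \<Longrightarrow> measure ?M (A i) \<le> ?e"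
    and good: "\<And>z. z \<in> space ?M - Bad \<Longrightarrow>
        misclass n (\<lambda>i. sgn (vec_index (u z) i)) y \<le> (1 / real n) * real (card ({..<n} \<inter> {i. z \<in> A i}))"
    by (rule misclassification_events[OF n d y lead meas S \<delta>]) (blast+)
  \<comment> \<open>An integrable majorant of the loss: on \<open>Bad\<close> the trivial bound 1 is
    used, elsewhere the fraction of indices whose event occurs.\<close>
  define f where "f z = indicator Bad z + (1 / real n) * (\<Sum>i<n. indicator (A i) z)" for z :: "nat \<times> nat \<Rightarrow> real"
  have int: "integrable ?M (indicator Bad :: _ \<Rightarrow> real)" "\<And>i. i < n \<Longrightarrow> integrable ?M (indicator (A i) :: _ \<Rightarrow> real)"
    using Bad A by (auto intro!: integrable_real_indicator simp: less_top[symmetric])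
  have fint: "integrable ?M f"
    unfolding f_def using int by (intro Bochner_Integration.integrable_add integrable_mult_right Bochner_Integration.integrable_sum) auto
  have f0: "0 \<le> f z" for z unfolding f_def by (intro add_nonneg_nonneg mult_nonneg_nonneg sum_nonneg) auto
  have le: "misclass n (\<lambda>i. sgn (vec_index (u z) i)) y \<le> f z" if z: "z \<in> space ?M" for z
  proof (cases "z \<in> Bad")
    case True
    have "misclass n (\<lambda>i. sgn (vec_index (u z) i)) y \<le> 1" using n by (intro misclass_le_1) simp
    also have "\<dots> \<le> f z" using True by (simp add: f_def sum_nonneg)
    finally show ?thesis .
  next
    case False
    have "(\<Sum>i<n. indicator (A i) z :: real) = (\<Sum>i<n. if z \<in> A i then 1 else 0)"
      by (intro sum.cong) (auto simp: indicator_def)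
    also have "\<dots> = real (card ({..<n} \<inter> {i. z \<in> A i}))" by (simp add: sum.If_cases)
    finally show ?thesis using good[of z] z False by (simp add: f_def)
  qed
  have "(\<integral>z. misclass n (\<lambda>i. sgn (vec_index (u z) i)) y \<partial>?M) \<le> (\<integral>z. f z \<partial>?M)"
    by (rule integral_mono'[OF fint le f0])
  also have "\<dots> = measure ?M Bad + (1 / real n) * (\<Sum>i<n. measure ?M (A i))"
  proof -
    have "(\<integral>z. f z \<partial>?M) = (\<integral>z. indicator Bad z \<partial>?M) + (\<integral>z. (1 / real n) * (\<Sum>i<n. indicator (A i) z) \<partial>?M)"
      unfolding f_def using int
      by (intro Bochner_Integration.integral_add integrable_mult_right Bochner_Integration.integrable_sum) auto
    also have "(\<integral>z. (1 / real n) * (\<Sum>i<n. indicator (A i) z) \<partial>?M) = (1 / real n) * (\<Sum>i<n. \<integral>z. indicator (A i) z \<partial>?M)"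
      using int by (subst Bochner_Integration.integral_mult_right_zero, subst Bochner_Integration.integral_sum) auto
    finally show ?thesis using Bad(1) A(1) sets.sets_into_space by (simp add: Int_absorb2 Int_absorb1)
  qed
  also have "\<dots> \<le> 4 * exp (- real n) + (1 / real n) * (\<Sum>i<n. ?e)"
    using Bad(2) A(2) by (intro add_mono mult_left_mono sum_mono) auto
  also have "(1 / real n) * (\<Sum>i<n. ?e) = ?e" using n by simp
  finally show ?thesis .
qed

lemma exact_recovery_prob_ge:
  fixes u :: "((nat \<times> nat) \<Rightarrow> real) \<Rightarrow> real vec"
  assumes n: "2 \<le> n" and d: "0 < d" and y: "\<And>i. i < n \<Longrightarrow> y i \<in> {-1, 1}"
    and lead: "\<And>z. z \<in> space (noise_space n d) \<Longrightarrow> leading_unit_eigvec (hollow_gram n d y mu z) (u z)"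
    and meas: "\<And>i. i < n \<Longrightarrow> (\<lambda>z. vec_index (u z) i) \<in> borel_measurable (noise_space n d)"
    and S: "1 \<le> SNR n d mu" and \<delta>: "2 / real n + 2580 / sqrt (SNR n d mu) \<le> \<delta>" "\<delta> \<le> 1 / 4"
  shows "1 - 4 * exp (- real n) - real n * (2 * exp (- ((1 - \<delta>) * SNR n d mu / 2)))
    \<le> measure (noise_space n d) {z \<in> space (noise_space n d). misclass n (\<lambda>i. sgn (vec_index (u z) i)) y = 0}"
proof -
  let ?M = "noise_space n d"
  let ?e = "2 * exp (- ((1 - \<delta>) * SNR n d mu / 2))"
  let ?E = "{z \<in> space ?M. misclass n (\<lambda>i. sgn (vec_index (u z) i)) y = 0}"
  interpret P: prob_space ?M unfolding noise_space_def by (rule prob_space_PiM_std_normal)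
  obtain Bad A where Bad: "Bad \<in> sets ?M" "measure ?M Bad \<le> 4 * exp (- real n)"
    and A: "\<And>i. i < n \<Longrightarrow> A i \<in> sets ?M" "\<And>i. i < n \<Longrightarrow> measure ?M (A i) \<le> ?e"
    and good: "\<And>z. z \<in> space ?M - Bad \<Longrightarrow>
        misclass n (\<lambda>i. sgn (vec_index (u z) i)) y \<le> (1 / real n) * real (card ({..<n} \<inter> {i. z \<in> A i}))"
    by (rule misclassification_events[OF n d y lead meas S \<delta>]) (blast+)
  \<comment> \<open>This form exhibits the recovery event as a finite combination of measurable
    coordinate conditions.\<close>
  have zero_iff: "misclass n f y = 0 \<longleftrightarrow> (\<forall>i\<in>{..<n}. f i = y i) \<or> (\<forall>i\<in>{..<n}. f i = - y i)" for f
  proof -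
    have "misclass n f y = 0 \<longleftrightarrow> card {i \<in> {..<n}. f i \<noteq> y i} = 0 \<or> card {i \<in> {..<n}. f i \<noteq> - y i} = 0"
      unfolding misclass_def using n by (simp del: card_eq_0_iff card_0_eq add: min_def) presburger
    then show ?thesis by auto
  qed
  have sm: "(\<lambda>z. sgn (vec_index (u z) i)) \<in> borel_measurable ?M" if "i < n" for i
    using meas[OF that] unfolding sgn_if by measurable
  have Em: "?E \<in> sets ?M"
    unfolding zero_iff
    by (intro sets.sets_Collect_disj sets.sets_Collect_finite_All borel_measurable_eq sm borel_measurable_const) auto
  let ?U = "Bad \<union> (\<Union>i<n. A i)"
  have Um: "(\<Union>i<n. A i) \<in> sets ?M" using A by auto
  have "space ?M - ?U \<subseteq> ?E"
  proof
    fix z assume z: "z \<in> space ?M - ?U"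
    then have "{..<n} \<inter> {i. z \<in> A i} = {}" by auto
    then have "misclass n (\<lambda>i. sgn (vec_index (u z) i)) y \<le> 0" using good[of z] z by simp
    moreover have "0 \<le> misclass n (\<lambda>i. sgn (vec_index (u z) i)) y" by (simp add: misclass_def)
    ultimately show "z \<in> ?E" using z by auto
  qed
  then have "measure ?M (space ?M - ?U) \<le> measure ?M ?E" by (rule P.finite_measure_mono[OF _ Em])
  moreover have "measure ?M (space ?M - ?U) = 1 - measure ?M ?U"
    using Bad Um by (intro P.prob_compl) auto
  moreover have "measure ?M ?U \<le> measure ?M Bad + measure ?M (\<Union>i<n. A i)"
    using Bad Um by (intro measure_Un_le) auto
  moreover have "measure ?M (\<Union>i<n. A i) \<le> (\<Sum>i<n. measure ?M (A i))"
    using A by (intro measure_UNION_le) auto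
  moreover have "(\<Sum>i<n. measure ?M (A i)) \<le> (\<Sum>i<n. ?e)" using A by (intro sum_mono) auto
  ultimately show ?thesis using Bad(2) by simp
qed

section \<open>Passage to the limit\<close>

lemma eventually_margin:
  assumes "filterlim S at_top sequentially" "0 < (\<delta>::real)"
  shows "\<forall>\<^sub>F n in sequentially. 1 \<le> S n \<and> 2 / real n + 2580 / sqrt (S n) \<le> \<delta>"
proof -
  have "((\<lambda>n. 2 / real n + 2580 / sqrt (S n)) \<longlongrightarrow> 0 + 0) sequentially"
  proof (intro tendsto_add)
    show "(\<lambda>n. 2 / real n) \<longlonglongrightarrow> 0" by real_asymp
    have "filterlim (\<lambda>n. sqrt (S n)) at_top sequentially"
      by (rule filterlim_compose[OF sqrt_at_top assms(1)])
    then show "(\<lambda>n. 2580 / sqrt (S n)) \<longlonglongrightarrow> 0"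
      by (rule real_tendsto_divide_at_top[OF tendsto_const])
  qed
  then have "\<forall>\<^sub>F n in sequentially. 2 / real n + 2580 / sqrt (S n) < \<delta>"
    using assms(2) by (intro order_tendstoD) auto
  moreover have "\<forall>\<^sub>F n in sequentially. 1 \<le> S n"
    using assms(1) by (simp add: filterlim_at_top)
  ultimately show ?thesis by eventually_elim auto
qed

theorem theorem3p2:
  fixes d :: "nat \<Rightarrow> nat"
    and y :: "nat \<Rightarrow> nat \<Rightarrow> real"
    and mu :: "nat \<Rightarrow> nat \<Rightarrow> real"
    and u :: "nat \<Rightarrow> ((nat \<times> nat) \<Rightarrow> real) \<Rightarrow> real vec"
  assumes d_ge: "\<And>n. n \<ge> 2 \<Longrightarrow> d n \<ge> 2"
    and y_pm: "\<And>n i. n \<ge> 2 \<Longrightarrow> i < n \<Longrightarrow> y n i \<in> {-1, 1}"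
    and u_lead: "\<And>n z. n \<ge> 2 \<Longrightarrow> z \<in> space (noise_space n (d n)) \<Longrightarrow>
                   leading_unit_eigvec (hollow_gram n (d n) (y n) (mu n) z) (u n z)"
    and u_meas: "\<And>n i. n \<ge> 2 \<Longrightarrow> i < n \<Longrightarrow>
                   (\<lambda>z. u n z $ i) \<in> borel_measurable (noise_space n (d n))"
  shows
    "(\<forall>\<epsilon>>0. (\<forall>n\<ge>2. SNR n (d n) (mu n) > (2 + \<epsilon>) * ln (real n)) \<longrightarrow>
        ((\<lambda>n. measure (noise_space n (d n))
               {z \<in> space (noise_space n (d n)).
                  misclass n (\<lambda>i. sgn (u n z $ i)) (y n) = 0}) \<longlonglongrightarrow> 1))
     \<and>
     ((filterlim (\<lambda>n. SNR n (d n) (mu n)) at_top sequentially \<and>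
       (\<forall>n\<ge>2. SNR n (d n) (mu n) \<le> 2 * ln (real n))) \<longrightarrow>
        limsup (\<lambda>n. ln_ext (\<integral>z. misclass n (\<lambda>i. sgn (u n z $ i)) (y n) \<partial>noise_space n (d n))
                     / ereal (SNR n (d n) (mu n))) \<le> ereal (-1/2))"
proof (intro conjI allI impI)
  define S where "S n = SNR n (d n) (mu n)" for n
  have d0: "0 < d n" if "2 \<le> n" for n using d_ge[OF that] by simp
  fix \<epsilon> :: real assume \<epsilon>: "0 < \<epsilon>" and snr: "\<forall>n\<ge>2. SNR n (d n) (mu n) > (2 + \<epsilon>) * ln (real n)"
  \<comment> \<open>Chosen so that \<open>(1 - \<delta>) * (2 + \<epsilon>) / 2\<close> is at least
    \<open>1 + \<epsilon> / 4\<close>. The union bound over \<open>n\<close> indices then still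
    leaves the decay of \<open>n\<close> to the power \<open>- \<epsilon> / 4\<close>.\<close>
  define \<delta> where "\<delta> = min (1 / 4) (\<epsilon> / 2 / (2 + \<epsilon>))"
  have \<delta>: "0 < \<delta>" "\<delta> \<le> 1 / 4" "\<delta> \<le> \<epsilon> / 2 / (2 + \<epsilon>)"
    using \<epsilon> unfolding \<delta>_def by (simp_all only: min.cobounded1 min.cobounded2) simp
  have "\<delta> * (2 + \<epsilon>) \<le> \<epsilon> / 2 / (2 + \<epsilon>) * (2 + \<epsilon>)" using \<delta> \<epsilon> by (intro mult_right_mono) auto
  also have "\<dots> = \<epsilon> / 2" using \<epsilon> by (intro nonzero_eq_divide_eq[THEN iffD1, OF _ refl]) simp
  finally have \<delta>\<epsilon>: "\<delta> * (2 + \<epsilon>) \<le> \<epsilon> / 2" .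
  have Stop: "filterlim S at_top sequentially"
  proof (rule filterlim_at_top_mono)
    show "filterlim (\<lambda>n::nat. (2 + \<epsilon>) * ln (real n)) at_top sequentially" using \<epsilon> by real_asymp
    show "\<forall>\<^sub>F n in sequentially. (2 + \<epsilon>) * ln (real n) \<le> S n"
      using eventually_ge_at_top[of 2] by eventually_elim (use snr in \<open>auto simp: S_def less_imp_le\<close>)
  qed
  let ?p = "\<lambda>n. measure (noise_space n (d n)) {z \<in> space (noise_space n (d n)). misclass n (\<lambda>i. sgn (u n z $ i)) (y n) = 0}"
  show "?p \<longlonglongrightarrow> 1"
  proof (rule tendsto_sandwich)
    show "\<forall>\<^sub>F n in sequentially. 1 - 4 * exp (- real n) - 2 * exp (- (\<epsilon> / 4 * ln (real n))) \<le> ?p n"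
      using eventually_margin[OF Stop \<delta>(1)] eventually_ge_at_top[of 2]
    proof eventually_elim
      case (elim n)
      have ln0: "0 \<le> ln (real n)" using elim by simp
      have "(1 + \<epsilon> / 4) * ln (real n) \<le> (1 - \<delta>) * (2 + \<epsilon>) / 2 * ln (real n)"
        using \<delta>\<epsilon> ln0 by (intro mult_right_mono) (auto simp: algebra_simps)
      also have "\<dots> = (1 - \<delta>) * ((2 + \<epsilon>) * ln (real n)) / 2" by simp
      also have "\<dots> \<le> (1 - \<delta>) * S n / 2"
        using \<delta> snr elim by (intro divide_right_mono mult_left_mono) (auto simp: S_def less_imp_le)
      finally have e: "(1 + \<epsilon> / 4) * ln (real n) \<le> (1 - \<delta>) * S n / 2" .
      have "real n * (2 * exp (- ((1 - \<delta>) * S n / 2))) \<le> real n * (2 * exp (- ((1 + \<epsilon> / 4) * ln (real n))))"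
        using e by (intro mult_left_mono) auto
      also have "\<dots> = 2 * (exp (ln (real n)) * exp (- ((1 + \<epsilon> / 4) * ln (real n))))" using elim by simp
      also have "exp (ln (real n)) * exp (- ((1 + \<epsilon> / 4) * ln (real n))) = exp (- (\<epsilon> / 4 * ln (real n)))"
        unfolding exp_add[symmetric] by (simp add: algebra_simps)
      finally show ?case
        using exact_recovery_prob_ge[of n "d n" "y n" "mu n" "u n" \<delta>] d0 y_pm u_lead u_meas elim \<delta>(2)
        by (simp add: S_def)
    qed
    show "\<forall>\<^sub>F n in sequentially. ?p n \<le> 1"
      by (intro always_eventually allI prob_space.prob_le_1) (simp add: noise_space_def prob_space_PiM_std_normal)
    show "(\<lambda>n. 1 - 4 * exp (- real n) - 2 * exp (- (\<epsilon> / 4 * ln (real n)))) \<longlonglongrightarrow> 1"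
      using \<epsilon> by real_asymp
  qed simp
next
  define S where "S n = SNR n (d n) (mu n)" for n
  have d0: "0 < d n" if "2 \<le> n" for n using d_ge[OF that] by simp
  assume "filterlim (\<lambda>n. SNR n (d n) (mu n)) at_top sequentially \<and> (\<forall>n\<ge>2. SNR n (d n) (mu n) \<le> 2 * ln (real n))"
  then have Stop: "filterlim S at_top sequentially" and Sle: "\<And>n. 2 \<le> n \<Longrightarrow> S n \<le> 2 * ln (real n)"
    by (auto simp: S_def[abs_def])
  let ?I = "\<lambda>n. \<integral>z. misclass n (\<lambda>i. sgn (u n z $ i)) (y n) \<partial>noise_space n (d n)"
  have "limsup (\<lambda>n. ln_ext (?I n) / ereal (S n)) \<le> ereal (- 1 / 2) + ereal e" if e: "0 < e" for e
  proof (rule Limsup_bounded)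
    define \<delta> where "\<delta> = min (1 / 4) e"
    have \<delta>: "0 < \<delta>" "\<delta> \<le> 1 / 4" "\<delta> \<le> e" using e by (auto simp: \<delta>_def)
    \<comment> \<open>The prefactor 6 that will arise contributes \<open>ln 6\<close> to the
      logarithm; for large \<open>S n\<close> this is at most half of the tolerance
      \<open>e\<close>.\<close>
    have "\<forall>\<^sub>F n in sequentially. 2 * ln 6 / e \<le> S n" using Stop by (simp add: filterlim_at_top)
    then show "\<forall>\<^sub>F n in sequentially. ln_ext (?I n) / ereal (S n) \<le> ereal (- 1 / 2) + ereal e"
      using eventually_margin[OF Stop \<delta>(1)] eventually_ge_at_top[of 2]
    proof eventually_elim
      case (elim n)
      have S0: "0 < S n" using elim by simp
      \<comment> \<open>The upper bound on the ratio enters here: it makes the failure probability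
        of order \<open>exp (- n)\<close> no larger than the main term, so that 4 + 2 = 6 copies of
        the latter suffice.\<close>
      have "S n / 2 \<le> ln (real n)" using Sle[of n] elim by linarith
      also have "\<dots> \<le> real n" using elim ln_le_minus_one[of "real n"] by simp
      finally have "S n / 2 \<le> real n" .
      moreover have "(1 - \<delta>) * S n \<le> 1 * S n" using \<delta>(1) S0 by (intro mult_right_mono) auto
      ultimately have "(1 - \<delta>) * S n / 2 \<le> real n" by linarith
      moreover have "?I n \<le> 4 * exp (- real n) + 2 * exp (- ((1 - \<delta>) * S n / 2))"
        using expectation_misclass_le[of n "d n" "y n" "mu n" "u n" \<delta>] d0 y_pm u_lead u_meas elim \<delta>(2)
        by (simp add: S_def)
      moreover have "exp (- real n) \<le> exp (- ((1 - \<delta>) * S n / 2))" using calculation(1) by simp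
      ultimately have I: "?I n \<le> 6 * exp (- ((1 - \<delta>) * S n / 2))" by linarith
      show ?case
      proof (cases "?I n \<le> 0")
        \<comment> \<open>Here \<open>ln_ext\<close> is minus infinity, and so is its quotient by
          the positive \<open>S n\<close>.\<close>
        case True
        then show ?thesis using S0 by (simp add: ln_ext_def)
      next
        case False
        then have "ln (?I n) \<le> ln (6 * exp (- ((1 - \<delta>) * S n / 2)))" using I by (subst ln_le_cancel_iff) auto
        also have "\<dots> = ln 6 - (1 - \<delta>) * S n / 2" by (simp add: ln_mult)
        also have "ln 6 \<le> e / 2 * S n" using elim e by (simp add: field_simps)
        also have "e / 2 * S n - (1 - \<delta>) * S n / 2 = (- 1 / 2 + e / 2 + \<delta> / 2) * S n" by (simp add: field_simps)
        also have "\<dots> \<le> (- 1 / 2 + e) * S n" using \<delta>(3) S0 by (intro mult_right_mono) auto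
        finally have "ln (?I n) / S n \<le> - 1 / 2 + e" using S0 by (simp add: pos_divide_le_eq)
        then show ?thesis using False S0 by (simp add: ln_ext_def)
      qed
    qed
  qed
  then show "limsup (\<lambda>n. ln_ext (?I n) / ereal (SNR n (d n) (mu n))) \<le> ereal (- 1 / 2)"
    unfolding S_def by (rule ereal_le_epsilon2)
qed

end
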